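(* Let $d\ge 1$, let $r_i>0$, $s_i>0$ $(i=1,\dots,d)$ be known constants, and let $\lambda=(\lambda_1,\dots,\lambda_d)$ with $\lambda_i>0$ be an unknown parameter. Suppose that $x_i$ and $y_i$ $(i=1,\dots,d)$ are all independent, where $x_i$ is Poisson distributed with mean $r_i\lambda_i$ and $y_i$ is Poisson distributed with mean $s_i\lambda_i$. Let $\beta_i>0$ $(i=1,\dots,d)$ and assume $\beta_{\bullet}:=\sum_{i=1}^d\beta_i>1$. Let $p_\beta(y\mid x)$ be the Bayesian predictive density based on the prior $\pi_\beta(\lambda)=\lambda_1^{\beta_1-1}\cdots\lambda_d^{\beta_d-1}$. Let $$\pi^*_\beta(\lambda):=\frac{\lambda_1^{\beta_1-1}\cdots\lambda_d^{\beta_d-1}}{(\lambda_1/\gamma_1+\cdots+\lambda_d/\gamma_d)^{\alpha}},\qquad \alpha=\beta_{\bullet}-1,\qquad \gamma_i=\frac1{r_i}-\frac1{r_i+s_i}\quad(i=1,\dots,d).$$ Then the Bayesian predictive density based on $\pi^*_\beta$ is $$p^*_\beta(y\mid x)=p_\beta(y\mid x)\,\frac{K\!\left(\frac{s}{r},\,x+y+\beta,\,\alpha\right)}{K\!\left(\frac{s}{r+s},\,x+\beta,\,\alpha\right)},$$ where $\frac{s}{r}:=\left(\frac{s_1}{r_1},\dots,\frac{s_d}{r_d}\right)$ and $\frac{s}{r+s}:=\left(\frac{s_1}{r_1+s_1},\dots,\frac{s_d}{r_d+s_d}\right)$, and its risk is (strictly) smaller than the risk of $p_\beta(y\mid x)$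 for every $\lambda$.
   Context: Write $x=(x_1,\dots,x_d)$, $y=(y_1,\dots,y_d)\in\mathbb{N}_0^d$, $\beta=(\beta_1,\dots,\beta_d)$, and $$p(x\mid\lambda)=\prod_{i=1}^d\frac{(r_i\lambda_i)^{x_i}}{x_i!}e^{-r_i\lambda_i},\qquad p(y\mid\lambda)=\prod_{i=1}^d\frac{(s_i\lambda_i)^{y_i}}{y_i!}e^{-s_i\lambda_i}.$$ For a (possibly improper) prior density $\pi$ on $(0,\infty)^d$, the Bayesian predictive density based on $\pi$ is $$p_\pi(y\mid x):=\frac{\int p(y\mid\lambda)p(x\mid\lambda)\pi(\lambda)\,d\lambda}{\int p(x\mid\lambda)\pi(\lambda)\,d\lambda},\qquad d\lambda=d\lambda_1\cdots d\lambda_d.$$ The risk of a predictive density $\hat p(y;x)$ at $\lambda$ is the expected Kullback--Leibler divergence $$\sum_x\sum_y p(x\mid\lambda)\,p(y\mid\lambda)\log\frac{p(y\mid\lambda)}{\hat p(y;x)}.$$ For $\gamma\in\mathbb{R}^d$ with all $\gamma_i>0$, $w\in\mathbb{R}^d$ with $w_{\bullet}:=\sum_i w_i>0$, and $0<\alpha<w_{\bullet}$, define $$K(\gamma,w,\alpha):=\int_0^\infty u^{\alpha-1}\prod_{i=1}^d\frac{1}{(u/\gamma_i+1)^{w_i}}\,du.$$ *)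

theory Defs
  imports "HOL-Analysis.Analysis"
begin

text \<open>
  The dimension \<open>d \<ge> 1\<close> is the cardinality of the finite index type \<open>'n\<close>.
\<close>

text \<open>
  Joint probability of the counts \<open>x\<close> when the \<open>x $ i\<close> are independent Poisson variables with
  means \<open>c $ i * lam $ i\<close>. This is \<open>p(x | lam)\<close> for \<open>c = r\<close> and \<open>p(y | lam)\<close> for \<open>c = s\<close>; the
  independence of \<open>x\<close> and \<open>y\<close> is the product of the two in \<open>kl_term\<close> below.
\<close>

definition poisson_prob :: "real ^ 'n \<Rightarrow> nat ^ 'n \<Rightarrow> real ^ 'n \<Rightarrow> real" where
  "poisson_prob c x lam =
     (\<Prod>i\<in>UNIV. (c $ i * lam $ i) ^ (x $ i) / fact (x $ i) * exp (- (c $ i * lam $ i)))"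

definition pos_orthant :: "(real ^ 'n) set" where
  "pos_orthant = {lam. \<forall>i. 0 < lam $ i}"

definition bayes_predictive ::
  "real ^ 'n \<Rightarrow> real ^ 'n \<Rightarrow> (real ^ 'n \<Rightarrow> real) \<Rightarrow> nat ^ 'n \<Rightarrow> nat ^ 'n \<Rightarrow> real" where
  "bayes_predictive r s prior y x =
     (LINT lam:pos_orthant|lborel. poisson_prob s y lam * poisson_prob r x lam * prior lam) /
     (LINT lam:pos_orthant|lborel. poisson_prob r x lam * prior lam)"

definition kl_term ::
  "real ^ 'n \<Rightarrow> real ^ 'n \<Rightarrow> (nat ^ 'n \<Rightarrow> nat ^ 'n \<Rightarrow> real) \<Rightarrow> real ^ 'n \<Rightarrow> nat ^ 'n \<Rightarrow> nat ^ 'n \<Rightarrow> real" where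
  "kl_term r s q lam x y =
     poisson_prob r x lam * poisson_prob s y lam * ln (poisson_prob s y lam / q y x)"

definition risk ::
  "real ^ 'n \<Rightarrow> real ^ 'n \<Rightarrow> (nat ^ 'n \<Rightarrow> nat ^ 'n \<Rightarrow> real) \<Rightarrow> real ^ 'n \<Rightarrow> real" where
  "risk r s q lam = (\<Sum>\<^sub>\<infinity>x. \<Sum>\<^sub>\<infinity>y. kl_term r s q lam x y)"

definition K :: "real ^ 'n \<Rightarrow> real ^ 'n \<Rightarrow> real \<Rightarrow> real" where
  "K \<gamma> w \<alpha> =
     (LINT u:{0<..}|lborel. u powr (\<alpha> - 1) * (\<Prod>i\<in>UNIV. 1 / (u / \<gamma> $ i + 1) powr (w $ i)))"

definition power_prior :: "real ^ 'n \<Rightarrow> real ^ 'n \<Rightarrow> real" where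
  "power_prior \<beta> lam = (\<Prod>i\<in>UNIV. lam $ i powr (\<beta> $ i - 1))"

definition shrinkage_prior :: "real ^ 'n \<Rightarrow> real ^ 'n \<Rightarrow> real \<Rightarrow> real ^ 'n \<Rightarrow> real" where
  "shrinkage_prior \<beta> \<gamma> \<alpha> lam =
     (\<Prod>i\<in>UNIV. lam $ i powr (\<beta> $ i - 1)) / (\<Sum>i\<in>UNIV. lam $ i / \<gamma> $ i) powr \<alpha>"

end

theory Submission
  imports Defs
begin

text \<open>
  Since \<open>(\<Sum>i. lam $ i / \<gamma> $ i) powr - \<alpha>\<close> is a Gamma integral, Tonelli's theorem gives the predictive
  density of the shrinkage prior, with the correction factor \<open>K' z / K'' x\<close>, where \<open>z = x + y\<close>,
  \<open>K' z = K (s / r) (z + \<beta>) \<alpha>\<close> and \<open>K'' x = K (s / (r + s)) (x + \<beta>) \<alpha>\<close>. The risk difference is the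
  expectation of \<open>ln (K' z / K'' x)\<close>, and it is positive even conditionally on \<open>z\<close>. Indeed
  \<open>ln t \<ge> 1 - 1 / t\<close> reduces this to \<open>E (K'' x | z) < K' z\<close>. Given \<open>z\<close>, the counts \<open>x\<close> are
  binomial, so the binomial theorem evaluates the conditional expectation under the integral over
  \<open>u\<close>; for \<open>\<alpha> = (\<Sum>i. \<beta> $ i) - 1\<close> the substitution \<open>v = u / (u + 1)\<close> turns the result into the
  integral defining \<open>K' z\<close>, restricted to \<open>0 < v < 1\<close>.
\<close>

section \<open>Predictive densities in closed form\<close>

text \<open>Euler's integral with the variable rescaled by \<open>t\<close>. The
  \<open>ennreal\<close> form lets Tonelli's theorem be applied later without integrability
  conditions.\<close>

lemma nn_integral_gamma_kernel:
  fixes a t :: real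
  assumes "a > 0" "t > 0"
  shows "(\<integral>\<^sup>+x. ennreal (indicator {0<..} x * (x powr (a - 1) * exp (- (t * x)))) \<partial>lborel) =
    ennreal (Gamma a / t powr a)"
proof -
  have "ennreal (Gamma a) = (\<integral>\<^sup>+x. ennreal (indicator {0..} x * x powr (a - 1) / exp x) \<partial>lborel)"
    using Gamma_conv_nn_integral_real[OF assms(1)] by simp
  also have "\<dots> = (\<integral>\<^sup>+x. ennreal (indicator {0<..} x * (x powr (a - 1) * exp (- x))) \<partial>lborel)"
  proof (intro nn_integral_cong_AE)
    have "AE x in lborel. x \<noteq> (0::real)"
      by (rule AE_lborel_singleton)
    then show "AE x in lborel. ennreal (indicator {0..} x * x powr (a - 1) / exp x) =
        ennreal (indicator {0<..} x * (x powr (a - 1) * exp (- x)))"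
      by eventually_elim (auto simp: indicator_def exp_minus field_simps)
  qed
  also have "\<dots> = ennreal \<bar>t\<bar> * (\<integral>\<^sup>+x. ennreal (indicator {0<..} (0 + t * x) *
      ((0 + t * x) powr (a - 1) * exp (- (0 + t * x)))) \<partial>lborel)"
    using assms by (intro nn_integral_real_affine) auto
  also have "\<dots> = (\<integral>\<^sup>+x. ennreal (t powr a) * ennreal (indicator {0<..} x *
      (x powr (a - 1) * exp (- (t * x)))) \<partial>lborel)"
  proof -
    have "t * (indicator {0<..} (t * x) * ((t * x) powr (a - 1) * exp (- (t * x)))) =
       t powr a * (indicator {0<..} x * (x powr (a - 1) * exp (- (t * x))))" for x :: real
      using assms by (cases "x > 0")
        (auto simp: indicator_def zero_less_mult_iff powr_mult powr_diff)
    then show ?thesis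
      using assms by (subst nn_integral_cmult [symmetric])
        (auto simp flip: ennreal_mult' simp del: mult_cancel_right mult_cancel_left
          intro!: nn_integral_cong arg_cong [where f = ennreal])
  qed
  also have "\<dots> = ennreal (t powr a) *
      (\<integral>\<^sup>+x. ennreal (indicator {0<..} x * (x powr (a - 1) * exp (- (t * x)))) \<partial>lborel)"
    by (intro nn_integral_cmult) auto
  finally have "ennreal (1 / t powr a) * ennreal (Gamma a) = ennreal (1 / t powr a) * (ennreal (t powr a) *
      (\<integral>\<^sup>+x. ennreal (indicator {0<..} x * (x powr (a - 1) * exp (- (t * x)))) \<partial>lborel))"
    by simp
  also have "\<dots> = (\<integral>\<^sup>+x. ennreal (indicator {0<..} x * (x powr (a - 1) * exp (- (t * x)))) \<partial>lborel)"
    using assms by (simp add: mult.assoc [symmetric] ennreal_mult' [symmetric])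
  finally show ?thesis
    using assms by (simp add: ennreal_mult' [symmetric])
qed

text \<open>The product formula over \<open>Basis\<close>, carried over to coordinates: sending
  \<open>i\<close> to \<open>axis i 1\<close> is a bijection from the index type onto
  \<open>Basis\<close>.\<close>

lemma nn_integral_lborel_vec_prod:
  fixes f :: "'n::finite \<Rightarrow> real \<Rightarrow> ennreal"
  assumes [measurable]: "\<And>i. f i \<in> borel_measurable borel"
  shows "(\<integral>\<^sup>+x. (\<Prod>i\<in>UNIV. f i (x $ i)) \<partial>(lborel :: (real ^ 'n) measure)) =
    (\<Prod>i\<in>UNIV. \<integral>\<^sup>+x. f i x \<partial>lborel)"
proof -
  define e :: "'n \<Rightarrow> real ^ 'n" where "e = (\<lambda>i. axis i 1)"
  have inj: "inj e"
    by (auto simp: inj_def e_def axis_eq_axis)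
  have B: "Basis = range e"
    by (auto simp: Basis_vec_def e_def)
  have "(\<integral>\<^sup>+x. (\<Prod>b\<in>Basis. f (inv e b) (x \<bullet> b)) \<partial>(lborel :: (real ^ 'n) measure)) =
      (\<Prod>b\<in>Basis. \<integral>\<^sup>+x. f (inv e b) x \<partial>lborel)"
    by (intro nn_integral_lborel_prod) auto
  then show ?thesis
    unfolding B using inj by (simp add: prod.reindex inv_f_f) (simp add: e_def inner_axis)
qed

lemma sets_pos_orthant [measurable]: "pos_orthant \<in> sets borel"
  unfolding pos_orthant_def by measurable

lemma indicator_pos_orthant:
  "indicator pos_orthant lam = (\<Prod>i\<in>UNIV. indicator {0<..} (lam $ i) :: real)"
  by (auto simp: indicator_def pos_orthant_def intro!: prod.neutral)

lemma nn_integral_orthant_gamma: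
  fixes w t :: "real ^ 'n"
  assumes "\<And>i. w $ i > 0" "\<And>i. t $ i > 0"
  shows "(\<integral>\<^sup>+lam. ennreal (indicator pos_orthant lam *
      (\<Prod>i\<in>UNIV. lam $ i powr (w $ i - 1) * exp (- (t $ i * lam $ i)))) \<partial>lborel) =
    ennreal (\<Prod>i\<in>UNIV. Gamma (w $ i) / t $ i powr (w $ i))"
proof -
  have "(\<integral>\<^sup>+lam. ennreal (indicator pos_orthant lam *
      (\<Prod>i\<in>UNIV. lam $ i powr (w $ i - 1) * exp (- (t $ i * lam $ i)))) \<partial>lborel) =
    (\<integral>\<^sup>+lam. (\<Prod>i\<in>UNIV. ennreal (indicator {0<..} (lam $ i) *
      (lam $ i powr (w $ i - 1) * exp (- (t $ i * lam $ i))))) \<partial>lborel)"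
    by (subst prod_ennreal) (auto simp: indicator_pos_orthant prod.distrib)
  also have "\<dots> = (\<Prod>i\<in>UNIV. \<integral>\<^sup>+u. ennreal (indicator {0<..} u *
      (u powr (w $ i - 1) * exp (- (t $ i * u)))) \<partial>lborel)"
    by (rule nn_integral_lborel_vec_prod) measurable
  also have "\<dots> = (\<Prod>i\<in>UNIV. ennreal (Gamma (w $ i) / t $ i powr (w $ i)))"
    using assms by (intro prod.cong refl nn_integral_gamma_kernel)
  finally show ?thesis
    using assms by (simp add: prod_ennreal)
qed

section \<open>The integral \<open>K\<close> and its appearance in integrals over the
  orthant\<close>

definition K_integrand :: "real ^ 'n \<Rightarrow> real ^ 'n \<Rightarrow> real \<Rightarrow> real \<Rightarrow> real" where
  "K_integrand \<gamma> w \<alpha> u = u powr (\<alpha> - 1) * (\<Prod>i\<in>UNIV. 1 / (u / \<gamma> $ i + 1) powr (w $ i))"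

lemma K_eq: "K \<gamma> w \<alpha> = (LINT u:{0<..}|lborel. K_integrand \<gamma> w \<alpha> u)"
  by (simp add: K_def K_integrand_def)

lemma K_integrand_measurable [measurable]: "K_integrand \<gamma> w \<alpha> \<in> borel_measurable borel"
  unfolding K_integrand_def by measurable

lemma K_integrand_nonneg: "0 \<le> K_integrand \<gamma> w \<alpha> u"
  by (auto simp: K_integrand_def intro!: mult_nonneg_nonneg prod_nonneg)

lemma K_integrand_pos:
  assumes "\<And>i. \<gamma> $ i > 0" "u > 0"
  shows "0 < K_integrand \<gamma> w \<alpha> u"
proof -
  have "u / \<gamma> $ i + 1 > 0" for i
    using assms by (simp add: add_pos_pos)
  then have "u / \<gamma> $ i + 1 \<noteq> 0" for i
    by (metis less_irrefl)
  then show ?thesis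
    using assms by (auto simp: K_integrand_def intro!: mult_pos_pos prod_pos)
qed

text \<open>Links integrability over \<open>lborel\<close> with the gauge integral, where the
  integrals of powers and the change of variables are at hand.\<close>

lemma set_integrable_lborel_iff:
  fixes f :: "'a :: euclidean_space \<Rightarrow> real"
  assumes [measurable]: "f \<in> borel_measurable borel" "S \<in> sets borel"
  shows "set_integrable lborel S f \<longleftrightarrow> f absolutely_integrable_on S"
  unfolding set_integrable_def by (rule integrable_completion [symmetric]) measurable

text \<open>The integrand is at most \<open>u powr (\<alpha> - 1)\<close>, which is integrable near
  0 because \<alpha> > 0. Dropping the \<open>+ 1\<close> in each factor bounds it by a multiple of
  \<open>u powr (\<alpha> - 1 - W)\<close>, which is integrable at infinity because \<alpha> <
  \<open>W\<close>.\<close>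

lemma set_integrable_K_integrand:
  fixes \<gamma> w :: "real ^ 'n"
  assumes \<gamma>: "\<And>i. \<gamma> $ i > 0" and w: "\<And>i. w $ i > 0"
    and \<alpha>: "0 < \<alpha>" "\<alpha> < (\<Sum>i\<in>UNIV. w $ i)"
  shows "set_integrable lborel {0<..} (K_integrand \<gamma> w \<alpha>)"
proof -
  define W where "W = (\<Sum>i\<in>UNIV. w $ i)"
  define C where "C = (\<Prod>i\<in>UNIV. \<gamma> $ i powr (w $ i))"
  have bound0: "K_integrand \<gamma> w \<alpha> u \<le> u powr (\<alpha> - 1)" if "u > 0" for u
  proof -
    have "(\<Prod>i\<in>UNIV. 1 / (u / \<gamma> $ i + 1) powr (w $ i)) \<le> 1"
      using that \<gamma> w
      by (intro prod_le_1) (auto intro!: divide_le_eq_1 [THEN iffD2] ge_one_powr_ge_zero simp: less_imp_le)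
    then show ?thesis
      unfolding K_integrand_def by (simp add: mult_left_le)
  qed
  have bound1: "K_integrand \<gamma> w \<alpha> u \<le> C * u powr (\<alpha> - 1 - W)" if u: "u > 0" for u
  proof -
    have "(\<Prod>i\<in>UNIV. 1 / (u / \<gamma> $ i + 1) powr (w $ i)) \<le> (\<Prod>i\<in>UNIV. \<gamma> $ i powr (w $ i) * u powr - (w $ i))"
    proof (intro prod_mono conjI)
      fix i
      have "1 / (u / \<gamma> $ i + 1) powr (w $ i) \<le> 1 / (u / \<gamma> $ i) powr (w $ i)"
        using u \<gamma>[of i] w[of i] add_pos_pos [of "u / \<gamma> $ i" 1]
        by (intro divide_left_mono powr_mono2) (auto intro!: mult_pos_pos)
      also have "\<dots> = \<gamma> $ i powr (w $ i) * u powr - (w $ i)"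
        using u \<gamma>[of i] by (simp add: powr_divide powr_minus_divide)
      finally show "1 / (u / \<gamma> $ i + 1) powr (w $ i) \<le> \<gamma> $ i powr (w $ i) * u powr - (w $ i)" .
    qed auto
    also have "\<dots> = C * u powr (- W)"
      using u by (simp add: prod.distrib C_def W_def powr_sum sum_negf [symmetric])
    finally have "K_integrand \<gamma> w \<alpha> u \<le> u powr (\<alpha> - 1) * (C * u powr (- W))"
      unfolding K_integrand_def by (intro mult_left_mono) auto
    also have "\<dots> = C * u powr (\<alpha> - 1 - W)"
      by (simp add: powr_diff powr_minus_divide)
    finally show ?thesis .
  qed
  have i0: "set_integrable lborel {0<..1} (\<lambda>u::real. u powr (\<alpha> - 1))"
    using \<alpha> by (subst set_integrable_lborel_iff)
      (auto intro!: nonnegative_absolutely_integrable_1 integrable_on_powr_from_0')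
  have "(\<lambda>u::real. C * u powr (\<alpha> - 1 - W)) integrable_on {1..}"
    using has_integral_powr_to_inf [of "\<alpha> - 1 - W" 1] \<alpha>
    by (intro integrable_on_mult_right) (auto simp: W_def integrable_on_def)
  then have i1: "set_integrable lborel {1..} (\<lambda>u::real. C * u powr (\<alpha> - 1 - W))"
    using \<gamma> by (subst set_integrable_lborel_iff)
      (auto intro!: nonnegative_absolutely_integrable_1 mult_nonneg_nonneg prod_nonneg simp: C_def)
  have "set_integrable lborel {0<..1} (K_integrand \<gamma> w \<alpha>)"
    by (rule set_integrable_bound [OF i0]) (auto simp: set_borel_measurable_def bound0 K_integrand_nonneg)
  moreover have "set_integrable lborel {1..} (K_integrand \<gamma> w \<alpha>)"
    by (rule set_integrable_bound [OF i1]) (auto simp: set_borel_measurable_def abs_of_nonneg [OF K_integrand_nonneg]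
      intro!: order_trans [OF bound1 abs_ge_self])
  ultimately have "set_integrable lborel ({0<..1} \<union> {1..}) (K_integrand \<gamma> w \<alpha>)"
    by (intro set_integrable_Un) auto
  also have "{0<..1} \<union> {1..} = {0::real<..}"
    by auto
  finally show ?thesis .
qed

lemma nn_integral_K_integrand:
  assumes "\<And>i. \<gamma> $ i > 0" "\<And>i. w $ i > 0" "0 < \<alpha>" "\<alpha> < (\<Sum>i\<in>UNIV. w $ i)"
  shows "(\<integral>\<^sup>+u. ennreal (indicator {0<..} u * K_integrand \<gamma> w \<alpha> u) \<partial>lborel) = ennreal (K \<gamma> w \<alpha>)"
  using set_integrable_K_integrand [OF assms]
  unfolding K_eq set_integrable_def set_lebesgue_integral_def
  by (subst nn_integral_eq_integral) (auto simp: K_integrand_nonneg)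

lemma K_nonneg: "K \<gamma> w \<alpha> \<ge> 0"
  unfolding K_eq set_lebesgue_integral_def
  by (intro Bochner_Integration.integral_nonneg) (auto simp: K_integrand_nonneg)

text \<open>Once the power of the sum is a Gamma integral over \<open>v\<close>, the integral over
  \<open>lam\<close> at fixed \<open>v\<close> is again one of Gamma kernels, now with rates
  \<open>t $ i + v / \<gamma> $ i\<close>. Factoring out \<open>t $ i\<close> leaves
  \<open>v / (t $ i * \<gamma> $ i) + 1\<close>, which explains the first argument of
  \<open>K\<close>.\<close>

lemma nn_integral_orthant_shrinkage:
  fixes w t \<gamma> :: "real ^ 'n"
  assumes w: "\<And>i. w $ i > 0" and t: "\<And>i. t $ i > 0" and \<gamma>: "\<And>i. \<gamma> $ i > 0"
    and \<alpha>: "0 < \<alpha>" "\<alpha> < (\<Sum>i\<in>UNIV. w $ i)"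
  shows "(\<integral>\<^sup>+lam. ennreal (indicator pos_orthant lam *
      ((\<Prod>i\<in>UNIV. lam $ i powr (w $ i - 1) * exp (- (t $ i * lam $ i))) /
       (\<Sum>i\<in>UNIV. lam $ i / \<gamma> $ i) powr \<alpha>)) \<partial>lborel) =
    ennreal ((\<Prod>i\<in>UNIV. Gamma (w $ i) / t $ i powr (w $ i)) * K (\<chi> i. t $ i * \<gamma> $ i) w \<alpha> / Gamma \<alpha>)"
    (is "?L = ennreal (?G * ?K / _)")
proof -
  define P where "P = (\<lambda>lam :: real ^ 'n. \<Prod>i\<in>UNIV. lam $ i powr (w $ i - 1) * exp (- (t $ i * lam $ i)))"
  define S where "S = (\<lambda>lam :: real ^ 'n. \<Sum>i\<in>UNIV. lam $ i / \<gamma> $ i)"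
  define F where "F = (\<lambda>(lam :: real ^ 'n) v. indicator pos_orthant lam * P lam *
    (indicator {0<..} v * (v powr (\<alpha> - 1) * exp (- (S lam * v)))))"
  have [measurable]: "P \<in> borel_measurable borel" "S \<in> borel_measurable borel"
    unfolding P_def S_def by measurable
  have P_nonneg: "P lam \<ge> 0" for lam
    unfolding P_def by (intro prod_nonneg) auto
  have [measurable]: "(\<lambda>(lam, v). ennreal (F lam v)) \<in> borel_measurable (lborel \<Otimes>\<^sub>M lborel)"
    unfolding F_def by measurable
  have L: "?L = (\<integral>\<^sup>+lam. ennreal (indicator pos_orthant lam * (P lam / S lam powr \<alpha>)) \<partial>lborel)"
    by (simp add: P_def S_def)
  \<comment> \<open>The factor \<open>Gamma \<alpha>\<close> is what turns the negative power of
    \<open>S lam\<close> into the integral of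
    \<open>v powr (\<alpha> - 1) * exp (- (S lam * v))\<close> over \<open>v\<close>.\<close>
  have "ennreal (Gamma \<alpha>) * ?L = (\<integral>\<^sup>+lam. ennreal (Gamma \<alpha>) * ennreal (indicator pos_orthant lam * (P lam / S lam powr \<alpha>)) \<partial>lborel)"
    unfolding L by (subst nn_integral_cmult) measurable
  also have "\<dots> = (\<integral>\<^sup>+lam. \<integral>\<^sup>+v. ennreal (F lam v) \<partial>lborel \<partial>lborel)"
  proof (intro nn_integral_cong)
    fix lam :: "real ^ 'n"
    show "ennreal (Gamma \<alpha>) * ennreal (indicator pos_orthant lam * (P lam / S lam powr \<alpha>)) =
      (\<integral>\<^sup>+v. ennreal (F lam v) \<partial>lborel)"
    proof (cases "lam \<in> pos_orthant")
      case True
      then have "S lam > 0"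
        using \<gamma> unfolding S_def pos_orthant_def by (intro sum_pos) auto
      have "(\<integral>\<^sup>+v. ennreal (F lam v) \<partial>lborel) =
        ennreal (P lam) * (\<integral>\<^sup>+v. ennreal (indicator {0<..} v * (v powr (\<alpha> - 1) * exp (- (S lam * v)))) \<partial>lborel)"
        using True P_nonneg by (subst nn_integral_cmult [symmetric]) (auto simp: F_def ennreal_mult')
      also have "\<dots> = ennreal (P lam) * ennreal (Gamma \<alpha> / S lam powr \<alpha>)"
        using \<alpha> \<open>S lam > 0\<close> by (subst nn_integral_gamma_kernel) auto
      finally show ?thesis
        using True P_nonneg \<alpha> by (simp add: ennreal_mult' [symmetric] mult_ac)
    qed (simp add: F_def)
  qed
  also have "\<dots> = (\<integral>\<^sup>+v. \<integral>\<^sup>+lam. ennreal (F lam v) \<partial>lborel \<partial>lborel)"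
    by (intro lborel_pair.Fubini' [symmetric]) measurable
  also have "\<dots> = (\<integral>\<^sup>+v. ennreal ?G * ennreal (indicator {0<..} v * K_integrand (\<chi> i. t $ i * \<gamma> $ i) w \<alpha> v) \<partial>lborel)"
  proof (intro nn_integral_cong)
    fix v :: real
    show "(\<integral>\<^sup>+lam. ennreal (F lam v) \<partial>lborel) =
      ennreal ?G * ennreal (indicator {0<..} v * K_integrand (\<chi> i. t $ i * \<gamma> $ i) w \<alpha> v)"
    proof (cases "v > 0")
      case True
      define t' where "t' = (\<chi> i. t $ i + v / \<gamma> $ i)"
      have t': "t' $ i > 0" for i
        using True \<gamma> [of i] t [of i] by (simp add: t'_def add_pos_pos)
      have "P lam * exp (- (S lam * v)) =
          (\<Prod>i\<in>UNIV. lam $ i powr (w $ i - 1) * exp (- (t' $ i * lam $ i)))" for lam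
      proof -
        have "exp (- (S lam * v)) = (\<Prod>i\<in>UNIV. exp (- (lam $ i / \<gamma> $ i * v)))"
          by (simp add: S_def exp_sum [symmetric] sum_distrib_right sum_negf)
        then have "P lam * exp (- (S lam * v)) = P lam * (\<Prod>i\<in>UNIV. exp (- (lam $ i / \<gamma> $ i * v)))"
          by simp
        then show ?thesis
          unfolding P_def prod.distrib [symmetric] t'_def
          by (auto intro!: prod.cong simp: mult_exp_exp algebra_simps)
      qed
      then have "F lam v = v powr (\<alpha> - 1) * (indicator pos_orthant lam *
          (\<Prod>i\<in>UNIV. lam $ i powr (w $ i - 1) * exp (- (t' $ i * lam $ i))))" for lam
        using True by (simp add: F_def mult_ac)
      then have "(\<integral>\<^sup>+lam. ennreal (F lam v) \<partial>lborel) = ennreal (v powr (\<alpha> - 1)) *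
          (\<integral>\<^sup>+lam. ennreal (indicator pos_orthant lam *
            (\<Prod>i\<in>UNIV. lam $ i powr (w $ i - 1) * exp (- (t' $ i * lam $ i)))) \<partial>lborel)"
        by (subst nn_integral_cmult [symmetric]) (auto simp: ennreal_mult')
      also have "\<dots> = ennreal (v powr (\<alpha> - 1) * (\<Prod>i\<in>UNIV. Gamma (w $ i) / t' $ i powr (w $ i)))"
        using w t' by (subst nn_integral_orthant_gamma) (auto simp: ennreal_mult')
      also have "(\<Prod>i\<in>UNIV. Gamma (w $ i) / t' $ i powr (w $ i)) =
          ?G * (\<Prod>i\<in>UNIV. 1 / (v / (t $ i * \<gamma> $ i) + 1) powr (w $ i))"
      proof -
        have "t' $ i powr (w $ i) = t $ i powr (w $ i) * (v / (t $ i * \<gamma> $ i) + 1) powr (w $ i)" for i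
        proof -
          have "t' $ i = t $ i * (v / (t $ i * \<gamma> $ i) + 1)"
            using t [of i] \<gamma> [of i] by (simp add: t'_def field_simps)
          then show ?thesis
            using True t [of i] \<gamma> [of i] by (simp add: powr_mult)
        qed
        then show ?thesis
          by (simp add: prod.distrib [symmetric])
      qed
      finally show ?thesis
        using True w t by (subst ennreal_mult' [symmetric])
          (auto simp: K_integrand_def mult_ac intro!: prod_nonneg divide_nonneg_nonneg less_imp_le [OF Gamma_real_pos])
    qed (simp add: F_def)
  qed
  also have "\<dots> = ennreal ?G * ennreal ?K"
    using assms by (subst nn_integral_cmult) (auto simp: nn_integral_K_integrand)
  finally have "ennreal (1 / Gamma \<alpha>) * (ennreal (Gamma \<alpha>) * ?L) = ennreal (1 / Gamma \<alpha>) * (ennreal ?G * ennreal ?K)"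
    by simp
  then show ?thesis
    using \<alpha> Gamma_real_pos [OF \<alpha>(1)]
    by (simp add: mult.assoc [symmetric] ennreal_mult' [symmetric] ennreal_mult'' [symmetric] K_nonneg)
qed

section \<open>Likelihoods integrated against the two priors\<close>

text \<open>For a nonnegative function the Bochner integral is the real value of the extended
  integral, so the evaluations obtained by Tonelli's theorem carry over.\<close>

lemma LINT_eq_nn_integral:
  assumes "(\<integral>\<^sup>+x. ennreal (indicator S x * f x) \<partial>lborel) = ennreal c" "c \<ge> 0"
    and [measurable]: "f \<in> borel_measurable borel" "S \<in> sets borel"
    and "\<And>x. x \<in> S \<Longrightarrow> f x \<ge> 0"
  shows "(LINT x:S|lborel. f x) = (c :: real)"
proof -
  have "AE x in lborel. 0 \<le> indicator S x * f x"
    using assms(5) by (auto simp: indicator_def)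
  then show ?thesis
    unfolding set_lebesgue_integral_def using assms(1,2)
    by (subst integral_eq_nn_integral) auto
qed

text \<open>Conjugacy of the Gamma and Poisson families: up to a constant, each coordinate carries a
  Gamma density with shape \<open>x $ i + \<beta> $ i\<close> and rate \<open>r $ i\<close>.\<close>

lemma poisson_prob_mult_prior:
  assumes "lam \<in> pos_orthant"
  shows "poisson_prob r x lam * power_prior \<beta> lam =
    (\<Prod>i\<in>UNIV. r $ i ^ (x $ i) / fact (x $ i)) *
    (\<Prod>i\<in>UNIV. lam $ i powr (real (x $ i) + \<beta> $ i - 1) * exp (- (r $ i * lam $ i)))"
  unfolding poisson_prob_def power_prior_def prod.distrib [symmetric]
proof (intro prod.cong refl)
  fix i
  have "lam $ i > 0"
    using assms by (auto simp: pos_orthant_def)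
  then show "(r $ i * lam $ i) ^ (x $ i) / fact (x $ i) * exp (- (r $ i * lam $ i)) * lam $ i powr (\<beta> $ i - 1) =
      r $ i ^ (x $ i) / fact (x $ i) * (lam $ i powr (real (x $ i) + \<beta> $ i - 1) * exp (- (r $ i * lam $ i)))"
    by (simp add: power_mult_distrib powr_add powr_diff powr_realpow)
qed

text \<open>The second observation raises the shape by \<open>y $ i\<close> and the rate by
  \<open>s $ i\<close>.\<close>

lemma poisson_prob_mult_mult_prior:
  assumes "lam \<in> pos_orthant"
  shows "poisson_prob s y lam * poisson_prob r x lam * power_prior \<beta> lam =
    (\<Prod>i\<in>UNIV. s $ i ^ (y $ i) / fact (y $ i)) * (\<Prod>i\<in>UNIV. r $ i ^ (x $ i) / fact (x $ i)) *
    (\<Prod>i\<in>UNIV. lam $ i powr (real (x $ i) + real (y $ i) + \<beta> $ i - 1) * exp (- ((r $ i + s $ i) * lam $ i)))"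
  unfolding poisson_prob_def power_prior_def prod.distrib [symmetric]
proof (intro prod.cong refl)
  fix i
  have "lam $ i > 0"
    using assms by (auto simp: pos_orthant_def)
  then show "(s $ i * lam $ i) ^ (y $ i) / fact (y $ i) * exp (- (s $ i * lam $ i)) *
      ((r $ i * lam $ i) ^ (x $ i) / fact (x $ i) * exp (- (r $ i * lam $ i))) * lam $ i powr (\<beta> $ i - 1) =
    s $ i ^ (y $ i) / fact (y $ i) * (r $ i ^ (x $ i) / fact (x $ i)) *
    (lam $ i powr (real (x $ i) + real (y $ i) + \<beta> $ i - 1) * exp (- ((r $ i + s $ i) * lam $ i)))"
    by (simp add: power_mult_distrib powr_add powr_diff powr_realpow ring_distribs exp_add exp_diff exp_minus field_simps)
qed

lemma shrinkage_prior_eq: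
  "shrinkage_prior \<beta> \<gamma> \<alpha> lam = power_prior \<beta> lam / (\<Sum>i\<in>UNIV. lam $ i / \<gamma> $ i) powr \<alpha>"
  by (simp add: shrinkage_prior_def power_prior_def)

lemma LINT_orthant_gamma:
  fixes w t :: "real ^ 'n"
  assumes "\<And>i. w $ i > 0" "\<And>i. t $ i > 0"
  shows "(LINT lam:pos_orthant|lborel. (\<Prod>i\<in>UNIV. lam $ i powr (w $ i - 1) * exp (- (t $ i * lam $ i)))) =
    (\<Prod>i\<in>UNIV. Gamma (w $ i) / t $ i powr (w $ i))"
  using assms by (intro LINT_eq_nn_integral nn_integral_orthant_gamma)
    (auto intro!: prod_nonneg divide_nonneg_nonneg less_imp_le [OF Gamma_real_pos])

lemma LINT_orthant_shrinkage:
  fixes w t \<gamma> :: "real ^ 'n"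
  assumes "\<And>i. w $ i > 0" "\<And>i. t $ i > 0" "\<And>i. \<gamma> $ i > 0"
    "0 < \<alpha>" "\<alpha> < (\<Sum>i\<in>UNIV. w $ i)"
  shows "(LINT lam:pos_orthant|lborel. (\<Prod>i\<in>UNIV. lam $ i powr (w $ i - 1) * exp (- (t $ i * lam $ i))) /
       (\<Sum>i\<in>UNIV. lam $ i / \<gamma> $ i) powr \<alpha>) =
    (\<Prod>i\<in>UNIV. Gamma (w $ i) / t $ i powr (w $ i)) * K (\<chi> i. t $ i * \<gamma> $ i) w \<alpha> / Gamma \<alpha>"
  using assms by (intro LINT_eq_nn_integral nn_integral_orthant_shrinkage)
    (auto intro!: prod_nonneg divide_nonneg_nonneg mult_nonneg_nonneg less_imp_le [OF Gamma_real_pos] K_nonneg)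

text \<open>A quotient of Gamma normalising constants in which the likelihood constant of
  \<open>x\<close> cancels. The result is a product of negative binomial probabilities with
  parameters \<open>x $ i + \<beta> $ i\<close> and \<open>r $ i / (r $ i + s $ i)\<close>.\<close>

lemma bayes_predictive_power_prior:
  fixes r s \<beta> :: "real ^ 'n"
  assumes r: "\<And>i. r $ i > 0" and s: "\<And>i. s $ i > 0" and \<beta>: "\<And>i. \<beta> $ i > 0"
  shows "bayes_predictive r s (power_prior \<beta>) y x =
    (\<Prod>i\<in>UNIV. s $ i ^ (y $ i) / fact (y $ i) *
      (Gamma (real (x $ i) + real (y $ i) + \<beta> $ i) / (r $ i + s $ i) powr (real (x $ i) + real (y $ i) + \<beta> $ i)) /
      (Gamma (real (x $ i) + \<beta> $ i) / r $ i powr (real (x $ i) + \<beta> $ i)))"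
proof -
  have [measurable]: "pos_orthant \<in> sets (lborel :: (real ^ 'n) measure)"
    by simp
  \<comment> \<open>Shapes and rates are written as vectors with \<open>\<chi>\<close> so that the
    integrand matches \<open>LINT_orthant_gamma\<close>.\<close>
  have "(LINT lam:pos_orthant|lborel. poisson_prob s y lam * poisson_prob r x lam * power_prior \<beta> lam) =
    (LINT lam:pos_orthant|lborel. (\<Prod>i\<in>UNIV. s $ i ^ (y $ i) / fact (y $ i)) * (\<Prod>i\<in>UNIV. r $ i ^ (x $ i) / fact (x $ i)) *
    (\<Prod>i\<in>UNIV. lam $ i powr ((\<chi> i. real (x $ i) + real (y $ i) + \<beta> $ i) $ i - 1) * exp (- ((\<chi> i. r $ i + s $ i) $ i * lam $ i))))"
    by (intro set_lebesgue_integral_cong) (auto simp: poisson_prob_mult_mult_prior)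
  also have "\<dots> = (\<Prod>i\<in>UNIV. s $ i ^ (y $ i) / fact (y $ i)) * (\<Prod>i\<in>UNIV. r $ i ^ (x $ i) / fact (x $ i)) *
     (\<Prod>i\<in>UNIV. Gamma (real (x $ i) + real (y $ i) + \<beta> $ i) / (r $ i + s $ i) powr (real (x $ i) + real (y $ i) + \<beta> $ i))"
    unfolding set_integral_mult_right
    using assms by (subst LINT_orthant_gamma) (auto simp: add_pos_pos add_nonneg_pos)
  finally have N: "(LINT lam:pos_orthant|lborel. poisson_prob s y lam * poisson_prob r x lam * power_prior \<beta> lam) = \<dots>" .
  have "(LINT lam:pos_orthant|lborel. poisson_prob r x lam * power_prior \<beta> lam) =
    (LINT lam:pos_orthant|lborel. (\<Prod>i\<in>UNIV. r $ i ^ (x $ i) / fact (x $ i)) *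
    (\<Prod>i\<in>UNIV. lam $ i powr ((\<chi> i. real (x $ i) + \<beta> $ i) $ i - 1) * exp (- (r $ i * lam $ i))))"
    by (intro set_lebesgue_integral_cong) (auto simp: poisson_prob_mult_prior)
  also have "\<dots> = (\<Prod>i\<in>UNIV. r $ i ^ (x $ i) / fact (x $ i)) *
     (\<Prod>i\<in>UNIV. Gamma (real (x $ i) + \<beta> $ i) / r $ i powr (real (x $ i) + \<beta> $ i))"
    unfolding set_integral_mult_right
    using assms by (subst LINT_orthant_gamma) (auto simp: add_pos_pos add_nonneg_pos)
  finally have D: "(LINT lam:pos_orthant|lborel. poisson_prob r x lam * power_prior \<beta> lam) = \<dots>" .
  have cancel: "a * b * g / (b * h) = a * g / h" if "b \<noteq> 0" for a b g h :: real
    using that by simp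
  have nz: "(\<Prod>i\<in>UNIV. r $ i ^ (x $ i) / fact (x $ i)) \<noteq> 0"
    using order.strict_implies_not_eq [OF r] by (metis (no_types, lifting) divide_eq_0_iff fact_nonzero finite power_not_zero prod_zero_iff)
  then show ?thesis
    unfolding bayes_predictive_def N D cancel [OF nz] by (simp only: prod.distrib prod_dividef)
qed

text \<open>Numerator and denominator are those of the power prior, each multiplied by a value of
  \<open>K\<close> and divided by \<open>Gamma \<alpha>\<close>; the latter cancels in the
  quotient.\<close>

lemma bayes_predictive_shrinkage_prior:
  fixes r s \<beta> \<gamma> :: "real ^ 'n"
  assumes r: "\<And>i. r $ i > 0" and s: "\<And>i. s $ i > 0" and \<beta>: "\<And>i. \<beta> $ i > 0"
    and \<alpha>: "0 < \<alpha>" "\<alpha> < (\<Sum>i\<in>UNIV. \<beta> $ i)"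
    and \<gamma>: "\<gamma> = (\<chi> i. 1 / r $ i - 1 / (r $ i + s $ i))"
  shows "bayes_predictive r s (shrinkage_prior \<beta> \<gamma> \<alpha>) y x =
    bayes_predictive r s (power_prior \<beta>) y x *
      (K (\<chi> i. s $ i / r $ i) (\<chi> i. real (x $ i) + real (y $ i) + \<beta> $ i) \<alpha> /
       K (\<chi> i. s $ i / (r $ i + s $ i)) (\<chi> i. real (x $ i) + \<beta> $ i) \<alpha>)"
proof -
  define S where "S = (\<lambda>lam :: real ^ 'n. (\<Sum>i\<in>UNIV. lam $ i / \<gamma> $ i) powr \<alpha>)"
  have [measurable]: "pos_orthant \<in> sets (lborel :: (real ^ 'n) measure)"
    by simp
  have \<gamma>_eq: "\<gamma> $ i = s $ i / (r $ i * (r $ i + s $ i))" for i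
    using r [of i] s [of i] by (simp add: \<gamma> field_simps)
  have \<gamma>_pos: "\<gamma> $ i > 0" for i
    using r [of i] s [of i] by (simp add: \<gamma>_eq)
  have rs: "r $ i + s $ i \<noteq> 0" "r $ i \<noteq> 0" for i
    using r [of i] s [of i] by auto
  \<comment> \<open>This is the effect of the choice of \<gamma>: multiplied by the rates
    \<open>r + s\<close> of the numerator and \<open>r\<close> of the denominator, it becomes
    \<open>s / r\<close> and \<open>s / (r + s)\<close>.\<close>
  have g1: "(\<chi> i. (r $ i + s $ i) * \<gamma> $ i) = (\<chi> i. s $ i / r $ i)"
    and g2: "(\<chi> i. r $ i * \<gamma> $ i) = (\<chi> i. s $ i / (r $ i + s $ i))"
    using rs by (auto simp: vec_eq_iff \<gamma>_eq)
  have w1: "\<alpha> < (\<Sum>i\<in>UNIV. (\<chi> i. real (x $ i) + real (y $ i) + \<beta> $ i) $ i)"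
    by (rule less_le_trans [OF \<alpha>(2)]) (auto intro: sum_mono)
  have w2: "\<alpha> < (\<Sum>i\<in>UNIV. (\<chi> i. real (x $ i) + \<beta> $ i) $ i)"
    by (rule less_le_trans [OF \<alpha>(2)]) (auto intro: sum_mono)
  let ?a = "\<Prod>i\<in>UNIV. s $ i ^ (y $ i) / fact (y $ i)" and ?b = "\<Prod>i\<in>UNIV. r $ i ^ (x $ i) / fact (x $ i)"
  let ?P1 = "\<lambda>lam. \<Prod>i\<in>UNIV. lam $ i powr ((\<chi> i. real (x $ i) + real (y $ i) + \<beta> $ i) $ i - 1) * exp (- ((\<chi> i. r $ i + s $ i) $ i * lam $ i))"
  let ?P2 = "\<lambda>lam. \<Prod>i\<in>UNIV. lam $ i powr ((\<chi> i. real (x $ i) + \<beta> $ i) $ i - 1) * exp (- (r $ i * lam $ i))"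
  let ?G1 = "\<Prod>i\<in>UNIV. Gamma (real (x $ i) + real (y $ i) + \<beta> $ i) / (r $ i + s $ i) powr (real (x $ i) + real (y $ i) + \<beta> $ i)"
  let ?G2 = "\<Prod>i\<in>UNIV. Gamma (real (x $ i) + \<beta> $ i) / r $ i powr (real (x $ i) + \<beta> $ i)"
  let ?K1 = "K (\<chi> i. s $ i / r $ i) (\<chi> i. real (x $ i) + real (y $ i) + \<beta> $ i) \<alpha>"
  let ?K2 = "K (\<chi> i. s $ i / (r $ i + s $ i)) (\<chi> i. real (x $ i) + \<beta> $ i) \<alpha>"
  have "(LINT lam:pos_orthant|lborel. poisson_prob s y lam * poisson_prob r x lam * shrinkage_prior \<beta> \<gamma> \<alpha> lam) =
    (LINT lam:pos_orthant|lborel. ?a * ?b * (?P1 lam / S lam))"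
    by (intro set_lebesgue_integral_cong)
      (auto simp: poisson_prob_mult_mult_prior [symmetric] shrinkage_prior_eq S_def)
  also have "\<dots> = ?a * ?b * (?G1 * ?K1 / Gamma \<alpha>)"
    unfolding set_integral_mult_right S_def
    using r s \<beta> \<alpha> \<gamma>_pos w1 by (subst LINT_orthant_shrinkage) (auto simp: add_pos_pos add_nonneg_pos g1)
  finally have N: "(LINT lam:pos_orthant|lborel. poisson_prob s y lam * poisson_prob r x lam * shrinkage_prior \<beta> \<gamma> \<alpha> lam) = \<dots>" .
  have "(LINT lam:pos_orthant|lborel. poisson_prob r x lam * shrinkage_prior \<beta> \<gamma> \<alpha> lam) =
    (LINT lam:pos_orthant|lborel. ?b * (?P2 lam / S lam))"
    by (intro set_lebesgue_integral_cong)
      (auto simp: poisson_prob_mult_prior [symmetric] shrinkage_prior_eq S_def)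
  also have "\<dots> = ?b * (?G2 * ?K2 / Gamma \<alpha>)"
    unfolding set_integral_mult_right S_def
    using r s \<beta> \<alpha> \<gamma>_pos w2 by (subst LINT_orthant_shrinkage) (auto simp: add_pos_pos add_nonneg_pos g2)
  finally have D: "(LINT lam:pos_orthant|lborel. poisson_prob r x lam * shrinkage_prior \<beta> \<gamma> \<alpha> lam) = \<dots>" .
  have cancel: "a * b * (g * k / c) / (b * (h * l / c)) = a * g / h * (k / l)"
    if "b \<noteq> 0" "c \<noteq> 0" for a b c g h k l :: real
    using that by simp
  have "?b \<noteq> 0"
    using rs by simp
  moreover have "Gamma \<alpha> \<noteq> 0"
    using Gamma_real_pos [OF \<alpha>(1)] by simp
  ultimately have "bayes_predictive r s (shrinkage_prior \<beta> \<gamma> \<alpha>) y x = ?a * ?G1 / ?G2 * (?K1 / ?K2)"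
    unfolding bayes_predictive_def N D by (rule cancel)
  also have "?a * ?G1 / ?G2 = bayes_predictive r s (power_prior \<beta>) y x"
    unfolding bayes_predictive_power_prior [OF r s \<beta>] by (simp only: prod.distrib prod_dividef)
  finally show ?thesis .
qed

section \<open>The conditional expectation given the total counts\<close>

text \<open>A nonnegative function with integral 0 vanishes almost everywhere, which is impossible
  if it is positive on a set that is not null. All strict inequalities between integrals below rest
  on this.\<close>

lemma set_lborel_integral_pos:
  fixes f :: "'a :: euclidean_space \<Rightarrow> real"
  assumes "set_integrable lborel S f" "\<And>x. x \<in> S \<Longrightarrow> f x > 0"
    and S: "S \<in> sets borel" "emeasure lborel S \<noteq> 0"
  shows "(LINT x:S|lborel. f x) > 0"
proof -
  have nonneg: "AE x in lborel. 0 \<le> indicator S x *\<^sub>R f x"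
    using assms(2) by (auto simp: indicator_def less_imp_le)
  have "(LINT x:S|lborel. f x) \<noteq> 0"
  proof
    assume "(LINT x:S|lborel. f x) = 0"
    then have "AE x in lborel. indicator S x *\<^sub>R f x = 0"
      using integral_nonneg_eq_0_iff_AE [OF _ nonneg] assms(1)
      by (simp add: set_lebesgue_integral_def set_integrable_def)
    then have "AE x in lborel. x \<notin> S"
      by eventually_elim (auto simp: indicator_def dest: assms(2) split: if_splits)
    then show False
      using S AE_iff_null_sets [of S lborel] by (simp add: null_sets_def)
  qed
  moreover have "(LINT x:S|lborel. f x) \<ge> 0"
    unfolding set_lebesgue_integral_def using nonneg by (intro integral_nonneg_AE)
  ultimately show ?thesis
    by simp
qed

lemma K_pos:
  fixes \<gamma> w :: "real ^ 'n"
  assumes "\<And>i. \<gamma> $ i > 0" "\<And>i. w $ i > 0" "0 < \<alpha>" "\<alpha> < (\<Sum>i\<in>UNIV. w $ i)"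
  shows "K \<gamma> w \<alpha> > 0"
  unfolding K_eq
proof (rule set_lborel_integral_pos)
  \<comment> \<open>The half-line is not null because it contains an interval of positive
    length.\<close>
  have "emeasure lborel {1..2::real} \<le> emeasure lborel {0::real<..}"
    by (intro emeasure_mono) auto
  then show "emeasure lborel {0::real<..} \<noteq> 0"
    by auto
qed (use assms in \<open>auto intro: set_integrable_K_integrand K_integrand_pos\<close>)

text \<open>The difference is the integral over \<open>{1..}\<close>, which is positive. This is the
  origin of the strict inequality between the risks.\<close>

lemma LINT_K_integrand_unit_less_K:
  fixes \<gamma> w :: "real ^ 'n"
  assumes "\<And>i. \<gamma> $ i > 0" "\<And>i. w $ i > 0" "0 < \<alpha>" "\<alpha> < (\<Sum>i\<in>UNIV. w $ i)"
  shows "(LINT u:{0<..<1}|lborel. K_integrand \<gamma> w \<alpha> u) < K \<gamma> w \<alpha>"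
proof -
  note int = set_integrable_K_integrand [OF assms]
  have int1: "set_integrable lborel {1..} (K_integrand \<gamma> w \<alpha>)"
    by (rule set_integrable_subset [OF int]) auto
  have "emeasure lborel {1..2::real} \<le> emeasure lborel {1::real..}"
    by (intro emeasure_mono) auto
  then have "(LINT u:{1..}|lborel. K_integrand \<gamma> w \<alpha> u) > 0"
    using assms by (intro set_lborel_integral_pos int1) (auto intro: K_integrand_pos)
  moreover have "K \<gamma> w \<alpha> = (LINT u:{0<..<1} \<union> {1..}|lborel. K_integrand \<gamma> w \<alpha> u)"
    unfolding K_eq by (intro arg_cong2 [where f = "\<lambda>S. set_lebesgue_integral lborel S"]) auto
  moreover have "\<dots> = (LINT u:{0<..<1}|lborel. K_integrand \<gamma> w \<alpha> u) + (LINT u:{1..}|lborel. K_integrand \<gamma> w \<alpha> u)"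
    by (intro set_integral_Un set_integrable_subset [OF int] int1) auto
  ultimately show ?thesis
    by simp
qed

section \<open>Poisson sums over the vectors below a given total\<close>

text \<open>The order on vectors is componentwise, so \<open>{..z}\<close> is a box; written as
  \<open>PiE\<close> it admits the distributive law for products of sums.\<close>

lemma bij_betw_vec_nth_atMost:
  "bij_betw vec_nth {..z :: nat ^ 'n} (PiE UNIV (\<lambda>i. {..z $ i}))"
  by (rule bij_betw_byWitness [where f' = vec_lambda]) (auto simp: less_eq_vec_def PiE_UNIV_domain Pi_iff)

lemma sum_atMost_vec_prod:
  fixes z :: "nat ^ 'n" and f :: "'n \<Rightarrow> nat \<Rightarrow> real"
  shows "(\<Sum>x\<in>{..z}. \<Prod>i\<in>UNIV. f i (x $ i)) = (\<Prod>i\<in>UNIV. \<Sum>k\<le>z $ i. f i k)"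
  by (subst prod_sum_PiE) (auto simp: sum.reindex_bij_betw [OF bij_betw_vec_nth_atMost, symmetric])

lemma finite_atMost_vec: "finite {..z :: nat ^ 'n}"
  by (rule bij_betw_finite [OF bij_betw_vec_nth_atMost, THEN iffD2]) (auto intro: finite_PiE)

text \<open>The binomial theorem divided by \<open>fact n\<close>. With \<open>q = 1\<close> it
  convolves two Poisson weights; general \<open>q\<close> gives the generating function of the first
  count, restricted to total \<open>n\<close>.\<close>

lemma poisson_convolution_pgf:
  fixes a b q :: real
  shows "(\<Sum>k\<le>n. a ^ k / fact k * (b ^ (n - k) / fact (n - k)) * q ^ k) = (a * q + b) ^ n / fact n"
proof -
  have "(a * q + b) ^ n / fact n = (\<Sum>k\<le>n. real (n choose k) * (a * q) ^ k * b ^ (n - k) / fact n)"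
    by (simp add: binomial_ring sum_divide_distrib)
  also have "\<dots> = (\<Sum>k\<le>n. a ^ k / fact k * (b ^ (n - k) / fact (n - k)) * q ^ k)"
    by (intro sum.cong refl) (auto simp: binomial_fact power_mult_distrib)
  finally show ?thesis ..
qed

text \<open>Sums of independent Poisson variables are Poisson. The factors
  \<open>1 ^ (x $ i)\<close> in the proof bring the sum into the form of
  \<open>poisson_convolution_pgf\<close> with \<open>q = 1\<close>.\<close>

lemma sum_poisson_convolution:
  fixes r s lam :: "real ^ 'n"
  shows "(\<Sum>x\<in>{..z}. poisson_prob r x lam * poisson_prob s (z - x) lam) = poisson_prob (r + s) z lam"
proof -
  have "(\<Sum>x\<in>{..z}. poisson_prob r x lam * poisson_prob s (z - x) lam) =
    (\<Sum>x\<in>{..z}. \<Prod>i\<in>UNIV. exp (- ((r + s) $ i * lam $ i)) *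
      ((r $ i * lam $ i) ^ (x $ i) / fact (x $ i) * ((s $ i * lam $ i) ^ (z $ i - x $ i) / fact (z $ i - x $ i)) * 1 ^ (x $ i)))"
    unfolding poisson_prob_def prod.distrib [symmetric]
    by (intro sum.cong prod.cong) (auto simp: mult_exp_exp algebra_simps)
  also have "\<dots> = (\<Prod>i\<in>UNIV. exp (- ((r + s) $ i * lam $ i)) *
      (\<Sum>k\<le>z $ i. (r $ i * lam $ i) ^ k / fact k * ((s $ i * lam $ i) ^ (z $ i - k) / fact (z $ i - k)) * 1 ^ k))"
    unfolding sum_distrib_left
    by (rule sum_atMost_vec_prod [where f = "\<lambda>i k. exp (- ((r + s) $ i * lam $ i)) *
      ((r $ i * lam $ i) ^ k / fact k * ((s $ i * lam $ i) ^ (z $ i - k) / fact (z $ i - k)) * 1 ^ k)"])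
  also have "\<dots> = poisson_prob (r + s) z lam"
    unfolding poisson_convolution_pgf by (simp add: poisson_prob_def algebra_simps)
  finally show ?thesis .
qed

text \<open>At fixed \<open>u\<close> the sum over \<open>x\<close> is a product of binomial
  generating functions. With \<open>v = u / (u + 1)\<close> the result is the integrand of the other
  \<open>K\<close> at \<open>v\<close>, times the derivative of \<open>v\<close> with respect to
  \<open>u\<close>.\<close>

lemma sum_poisson_K_integrand:
  fixes r s \<beta> lam :: "real ^ 'n"
  assumes r: "\<And>i. r $ i > 0" and s: "\<And>i. s $ i > 0"
    and \<alpha>: "\<alpha> = (\<Sum>i\<in>UNIV. \<beta> $ i) - 1" and u: "u > 0"
  shows "(\<Sum>x\<in>{..z}. poisson_prob r x lam * poisson_prob s (z - x) lam *
      K_integrand (\<chi> i. s $ i / (r $ i + s $ i)) (\<chi> i. real (x $ i) + \<beta> $ i) \<alpha> u) =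
    poisson_prob (r + s) z lam *
      (1 / (u + 1)\<^sup>2 * K_integrand (\<chi> i. s $ i / r $ i) (\<chi> i. real (z $ i) + \<beta> $ i) \<alpha> (u / (u + 1)))"
proof -
  \<comment> \<open>The base of the \<open>i\<close>-th factor of the integrand. The dependence on
    \<open>x\<close> is through the powers \<open>(1 / b i) ^ (x $ i)\<close>, so the generating
    function is taken at \<open>1 / b i\<close>.\<close>
  define b where "b = (\<lambda>i. u / (s $ i / (r $ i + s $ i)) + 1)"
  have b: "b i > 0" "b i \<noteq> 0" for i
    using u r [of i] s [of i] by (auto simp: b_def intro!: add_pos_pos add_nonneg_pos)
       (metis add_pos_pos divide_pos_pos less_irrefl mult_pos_pos zero_less_one)
  have "(\<Sum>x\<in>{..z}. poisson_prob r x lam * poisson_prob s (z - x) lam *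
      K_integrand (\<chi> i. s $ i / (r $ i + s $ i)) (\<chi> i. real (x $ i) + \<beta> $ i) \<alpha> u) =
    (\<Sum>x\<in>{..z}. u powr (\<alpha> - 1) * (\<Prod>i\<in>UNIV. exp (- ((r + s) $ i * lam $ i)) * b i powr (- \<beta> $ i) *
      ((r $ i * lam $ i) ^ (x $ i) / fact (x $ i) * ((s $ i * lam $ i) ^ (z $ i - x $ i) / fact (z $ i - x $ i)) * (1 / b i) ^ (x $ i))))"
  proof (intro sum.cong refl)
    fix x
    have "1 / b i powr (real (x $ i) + \<beta> $ i) = b i powr (- \<beta> $ i) * (1 / b i) ^ (x $ i)" for i
      using b [of i] by (simp add: powr_add powr_realpow powr_minus_divide power_divide)
    then have *: "K_integrand (\<chi> i. s $ i / (r $ i + s $ i)) (\<chi> i. real (x $ i) + \<beta> $ i) \<alpha> u =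
      u powr (\<alpha> - 1) * (\<Prod>i\<in>UNIV. b i powr (- \<beta> $ i) * (1 / b i) ^ (x $ i))"
      by (simp add: K_integrand_def b_def)
    have h: "poisson_prob r x lam * poisson_prob s (z - x) lam * (\<Prod>i\<in>UNIV. b i powr (- \<beta> $ i) * (1 / b i) ^ (x $ i)) =
      (\<Prod>i\<in>UNIV. exp (- ((r + s) $ i * lam $ i)) * b i powr (- \<beta> $ i) *
      ((r $ i * lam $ i) ^ (x $ i) / fact (x $ i) * ((s $ i * lam $ i) ^ (z $ i - x $ i) / fact (z $ i - x $ i)) * (1 / b i) ^ (x $ i)))"
      unfolding poisson_prob_def prod.distrib [symmetric]
      by (intro prod.cong) (auto simp: ring_distribs exp_add exp_diff exp_minus field_simps)
    show "poisson_prob r x lam * poisson_prob s (z - x) lam *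
      K_integrand (\<chi> i. s $ i / (r $ i + s $ i)) (\<chi> i. real (x $ i) + \<beta> $ i) \<alpha> u =
      u powr (\<alpha> - 1) * (\<Prod>i\<in>UNIV. exp (- ((r + s) $ i * lam $ i)) * b i powr (- \<beta> $ i) *
      ((r $ i * lam $ i) ^ (x $ i) / fact (x $ i) * ((s $ i * lam $ i) ^ (z $ i - x $ i) / fact (z $ i - x $ i)) * (1 / b i) ^ (x $ i)))"
      unfolding * h [symmetric] by (rule mult.left_commute)
  qed
  \<comment> \<open>The closed form on the right is expanded by the binomial theorem, and the
    product of sums is then multiplied out over the box.\<close>
  also have "\<dots> = u powr (\<alpha> - 1) * (\<Prod>i\<in>UNIV. exp (- ((r + s) $ i * lam $ i)) * b i powr (- \<beta> $ i) *
      ((r $ i * lam $ i * (1 / b i) + s $ i * lam $ i) ^ (z $ i) / fact (z $ i)))"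
    unfolding sum_distrib_left [symmetric] poisson_convolution_pgf [symmetric]
    by (rule arg_cong [where f = "\<lambda>t. u powr (\<alpha> - 1) * t"], unfold sum_distrib_left,
      rule sum_atMost_vec_prod [where f = "\<lambda>i k. exp (- ((r + s) $ i * lam $ i)) * b i powr (- \<beta> $ i) *
      ((r $ i * lam $ i) ^ k / fact k * ((s $ i * lam $ i) ^ (z $ i - k) / fact (z $ i - k)) * (1 / b i) ^ k)"])
  also have "\<dots> = u powr (\<alpha> - 1) * (\<Prod>i\<in>UNIV. ((r + s) $ i * lam $ i) ^ (z $ i) / fact (z $ i) * exp (- ((r + s) $ i * lam $ i)) *
      ((u + 1) powr (- \<beta> $ i) * (1 / (b i / (u + 1)) powr (real (z $ i) + \<beta> $ i))))"
  proof (intro arg_cong [where f = "\<lambda>y. _ * y"] prod.cong refl)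
    fix i
    \<comment> \<open>By the definition of \<open>b\<close>, \<open>r $ i + s $ i * b i\<close>
      equals \<open>(r $ i + s $ i) * (u + 1)\<close>. Hence the total mean splits off from the
      generating function.\<close>
    have f1: "r $ i * lam $ i * (1 / b i) + s $ i * lam $ i = (r + s) $ i * lam $ i * ((u + 1) / b i)"
    proof -
      have "s $ i * b i = u * (r $ i + s $ i) + s $ i"
        using s [of i] by (simp add: b_def field_simps)
      then have "r $ i + s $ i * b i = (r $ i + s $ i) * (u + 1)"
        by (simp add: algebra_simps)
      moreover have "r $ i * lam $ i * (1 / b i) + s $ i * lam $ i = lam $ i * (r $ i + s $ i * b i) / b i"
        using b [of i] by (simp add: field_simps)
      ultimately show ?thesis
        by simp
    qed
    have f2: "(u + 1) powr (- \<beta> $ i) * (1 / (b i / (u + 1)) powr (real (z $ i) + \<beta> $ i)) =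
      b i powr (- \<beta> $ i) * ((u + 1) / b i) ^ (z $ i)"
      using b [of i] u by (simp add: powr_divide powr_add powr_realpow powr_minus_divide power_divide)
    show "exp (- ((r + s) $ i * lam $ i)) * b i powr (- \<beta> $ i) *
      ((r $ i * lam $ i * (1 / b i) + s $ i * lam $ i) ^ (z $ i) / fact (z $ i)) =
      ((r + s) $ i * lam $ i) ^ (z $ i) / fact (z $ i) * exp (- ((r + s) $ i * lam $ i)) *
      ((u + 1) powr (- \<beta> $ i) * (1 / (b i / (u + 1)) powr (real (z $ i) + \<beta> $ i)))"
      unfolding f1 f2 power_mult_distrib [of "(r + s) $ i * lam $ i" "(u + 1) / b i"]
      by (simp only: mult_ac times_divide_eq_right times_divide_eq_left)
  qed
  also have "\<dots> = poisson_prob (r + s) z lam * (u powr (\<alpha> - 1) * (\<Prod>i\<in>UNIV. (u + 1) powr (- \<beta> $ i)) *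
     (\<Prod>i\<in>UNIV. 1 / (b i / (u + 1)) powr (real (z $ i) + \<beta> $ i)))"
    by (simp only: prod.distrib poisson_prob_def mult_ac)
  also have "u powr (\<alpha> - 1) * (\<Prod>i\<in>UNIV. (u + 1) powr (- \<beta> $ i)) = 1 / (u + 1)\<^sup>2 * (u / (u + 1)) powr (\<alpha> - 1)"
  proof -
    \<comment> \<open>Here the value of \<alpha> enters: the \<beta>'s sum to
      \<open>\<alpha> + 1\<close>, so besides the power that completes
      \<open>(u / (u + 1)) powr (\<alpha> - 1)\<close> exactly two factors
      \<open>1 / (u + 1)\<close> remain, and these form the Jacobian.\<close>
    have "(\<Prod>i\<in>UNIV. (u + 1) powr (- \<beta> $ i)) = (u + 1) powr (- (\<alpha> - 1) - 2)"
      using u by (subst powr_sum [symmetric]) (auto simp: \<alpha> sum_negf)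
    then show ?thesis
      using u by (simp add: powr_divide powr_diff powr_minus_divide power2_eq_square divide_simps)
  qed
  finally have main: "(\<Sum>x\<in>{..z}. poisson_prob r x lam * poisson_prob s (z - x) lam *
      K_integrand (\<chi> i. s $ i / (r $ i + s $ i)) (\<chi> i. real (x $ i) + \<beta> $ i) \<alpha> u) =
    poisson_prob (r + s) z lam * (1 / (u + 1)\<^sup>2 * (u / (u + 1)) powr (\<alpha> - 1) *
     (\<Prod>i\<in>UNIV. 1 / (b i / (u + 1)) powr (real (z $ i) + \<beta> $ i)))" .
  \<comment> \<open>The rescaled bases are those of the integrand with parameters
    \<open>s / r\<close>, evaluated at \<open>u / (u + 1)\<close>.\<close>
  have "b i / (u + 1) = u / (u + 1) / (s $ i / r $ i) + 1" for i
  proof -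
    have "u + 1 \<noteq> 0" "s $ i \<noteq> 0" "r $ i \<noteq> 0"
      using u s [of i] r [of i] by auto
    then show ?thesis
      by (simp add: b_def divide_simps) (simp add: algebra_simps)
  qed
  then show ?thesis
    unfolding main by (simp add: K_integrand_def mult.assoc)
qed

text \<open>The map \<open>u / (u + 1)\<close> takes the positive half-line bijectively onto the
  open unit interval, with derivative \<open>1 / (u + 1)\<^sup>2\<close>.\<close>

lemma LINT_substitute_unit:
  fixes f :: "real \<Rightarrow> real"
  assumes [measurable]: "f \<in> borel_measurable borel" and f: "set_integrable lborel {0<..<1} f"
  shows "(LINT u:{0<..}|lborel. 1 / (u + 1)\<^sup>2 * f (u / (u + 1))) = (LINT v:{0<..<1}|lborel. f v)"
proof -
  let ?g = "\<lambda>u :: real. u / (u + 1)" and ?g' = "\<lambda>u :: real. 1 / (u + 1)\<^sup>2"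
  have inj: "inj_on ?g {0<..}"
    by (rule inj_onI) (auto simp: field_simps add_eq_0_iff)
  have img: "?g ` {0<..} = {0<..<1}"
  proof (intro equalityI subsetI)
    fix v :: real assume "v \<in> {0<..<1}"
    then have "v = ?g (v / (1 - v))" "v / (1 - v) \<in> {0<..}"
      by (auto simp: field_simps)
    then show "v \<in> ?g ` {0<..}"
      by blast
  qed auto
  have der: "(?g has_field_derivative ?g' u) (at u within {0<..})" if "u \<in> {0<..}" for u
    using that by (auto intro!: derivative_eq_intros simp: field_simps power2_eq_square)
  \<comment> \<open>Integrability and value are stated jointly because the change of variables is an
    equivalence between two such conjunctions.\<close>
  have "f absolutely_integrable_on ?g ` {0<..} \<and> integral (?g ` {0<..}) f = (LINT v:{0<..<1}|lborel. f v)"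
    unfolding img using f by (auto simp: set_borel_integral_eq_integral(2) set_integrable_lborel_iff)
  then have *: "(\<lambda>u. \<bar>?g' u\<bar> * f (?g u)) absolutely_integrable_on {0<..} \<and>
      integral {0<..} (\<lambda>u. \<bar>?g' u\<bar> * f (?g u)) = (LINT v:{0<..<1}|lborel. f v)"
    by (subst has_absolute_integral_change_of_variables_1' [OF _ der inj]) auto
  then have "set_integrable lborel {0<..} (\<lambda>u. 1 / (u + 1)\<^sup>2 * f (u / (u + 1)))"
    by (subst set_integrable_lborel_iff) auto
  then show ?thesis
    using * by (simp add: set_borel_integral_eq_integral(2))
qed

text \<open>After division by \<open>poisson_prob (r + s) z lam\<close> the left side is the
  conditional expectation given the total \<open>z\<close>. Summation under the integral and
  substitution leave the integrand of the right-hand \<open>K\<close>, integrated over the unit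
  interval alone.\<close>

lemma sum_poisson_K_less:
  fixes r s \<beta> lam :: "real ^ 'n"
  assumes r: "\<And>i. r $ i > 0" and s: "\<And>i. s $ i > 0" and \<beta>: "\<And>i. \<beta> $ i > 0"
    and \<alpha>: "\<alpha> = (\<Sum>i\<in>UNIV. \<beta> $ i) - 1" "\<alpha> > 0" and lam: "lam \<in> pos_orthant"
  shows "(\<Sum>x\<in>{..z}. poisson_prob r x lam * poisson_prob s (z - x) lam *
      K (\<chi> i. s $ i / (r $ i + s $ i)) (\<chi> i. real (x $ i) + \<beta> $ i) \<alpha>) <
    poisson_prob (r + s) z lam * K (\<chi> i. s $ i / r $ i) (\<chi> i. real (z $ i) + \<beta> $ i) \<alpha>"
proof -
  let ?\<kappa> = "\<lambda>x. K_integrand (\<chi> i. s $ i / (r $ i + s $ i)) (\<chi> i. real (x $ i) + \<beta> $ i) \<alpha>"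
  let ?\<kappa>' = "K_integrand (\<chi> i. s $ i / r $ i) (\<chi> i. real (z $ i) + \<beta> $ i) \<alpha>"
  have w: "\<alpha> < (\<Sum>i\<in>UNIV. (\<chi> i. real (x $ i) + \<beta> $ i) $ i)" for x :: "nat ^ 'n"
    by (rule less_le_trans [of _ "\<Sum>i\<in>UNIV. \<beta> $ i"]) (auto intro: sum_mono simp: \<alpha>)
  have rs: "s $ i / (r $ i + s $ i) > 0" "s $ i / r $ i > 0" for i
    using r [of i] s [of i] by auto
  have int: "set_integrable lborel {0<..} (?\<kappa> x)" for x
    using rs \<beta> \<alpha>(2) w by (intro set_integrable_K_integrand) (auto simp: add_nonneg_pos)
  have int': "set_integrable lborel {0<..} ?\<kappa>'"
    using rs \<beta> \<alpha>(2) w by (intro set_integrable_K_integrand) (auto simp: add_nonneg_pos)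
  have pos: "poisson_prob (r + s) z lam > 0"
    using lam r s unfolding poisson_prob_def pos_orthant_def
    by (intro prod_pos) (auto intro!: mult_pos_pos divide_pos_pos zero_less_power add_pos_pos)
  have "(\<Sum>x\<in>{..z}. poisson_prob r x lam * poisson_prob s (z - x) lam *
      K (\<chi> i. s $ i / (r $ i + s $ i)) (\<chi> i. real (x $ i) + \<beta> $ i) \<alpha>) =
    (\<Sum>x\<in>{..z}. LINT u:{0<..}|lborel. poisson_prob r x lam * poisson_prob s (z - x) lam * ?\<kappa> x u)"
    by (simp add: K_eq)
  also have "\<dots> = (LINT u:{0<..}|lborel. \<Sum>x\<in>{..z}. poisson_prob r x lam * poisson_prob s (z - x) lam * ?\<kappa> x u)"
    unfolding set_lebesgue_integral_def scaleR_sum_right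
    by (rule Bochner_Integration.integral_sum [symmetric])
      (rule set_integrable_mult_right [OF int, unfolded set_integrable_def])
  also have "\<dots> = (LINT u:{0<..}|lborel. poisson_prob (r + s) z lam * (1 / (u + 1)\<^sup>2 * ?\<kappa>' (u / (u + 1))))"
    using r s \<alpha>(1) by (intro set_lebesgue_integral_cong) (auto simp: sum_poisson_K_integrand)
  also have "\<dots> = poisson_prob (r + s) z lam * (LINT u:{0<..<1}|lborel. ?\<kappa>' u)"
    unfolding set_integral_mult_right
    by (subst LINT_substitute_unit) (auto intro!: set_integrable_subset [OF int'])
  also have "\<dots> < poisson_prob (r + s) z lam * K (\<chi> i. s $ i / r $ i) (\<chi> i. real (z $ i) + \<beta> $ i) \<alpha>"
    using rs \<beta> \<alpha>(2) w
    by (intro mult_strict_left_mono LINT_K_integrand_unit_less_K pos) (auto simp: add_nonneg_pos)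
  finally show ?thesis .
qed

section \<open>Convergence of the risk\<close>

text \<open>Every finite set of vectors lies in a box, where the sum factorises and is at most the
  product of the coordinate sums.\<close>

lemma summable_on_vec_prod:
  fixes f :: "'n::finite \<Rightarrow> nat \<Rightarrow> real"
  assumes nonneg: "\<And>i k. f i k \<ge> 0" and sum: "\<And>i. f i summable_on UNIV"
  shows "(\<lambda>x :: nat ^ 'n. \<Prod>i\<in>UNIV. f i (x $ i)) summable_on UNIV"
proof (rule nonneg_bdd_above_summable_on)
  show "bdd_above (sum (\<lambda>x :: nat ^ 'n. \<Prod>i\<in>UNIV. f i (x $ i)) ` {F. F \<subseteq> UNIV \<and> finite F})"
  proof (rule bdd_aboveI2)
    fix F :: "(nat ^ 'n) set"
    assume "F \<in> {F. F \<subseteq> UNIV \<and> finite F}"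
    then have "finite F"
      by simp
    \<comment> \<open>The coordinatewise maximum of \<open>F\<close>. For empty \<open>F\<close> the
      inclusion below holds whatever the value of \<open>Max\<close>.\<close>
    define z where "z = (\<chi> i. Max ((\<lambda>x. x $ i) ` F))"
    have "F \<subseteq> {..z}"
      using \<open>finite F\<close> by (auto simp: z_def less_eq_vec_def)
    then have "(\<Sum>x\<in>F. \<Prod>i\<in>UNIV. f i (x $ i)) \<le> (\<Sum>x\<in>{..z}. \<Prod>i\<in>UNIV. f i (x $ i))"
      by (intro sum_mono2) (auto simp: finite_atMost_vec prod_nonneg nonneg)
    also have "\<dots> = (\<Prod>i\<in>UNIV. \<Sum>k\<le>z $ i. f i k)"
      by (rule sum_atMost_vec_prod)
    also have "\<dots> \<le> (\<Prod>i\<in>UNIV. infsum (f i) UNIV)"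
      by (intro prod_mono conjI sum_nonneg finite_sum_le_infsum) (auto simp: nonneg sum)
    finally show "(\<Sum>x\<in>F. \<Prod>i\<in>UNIV. f i (x $ i)) \<le> (\<Prod>i\<in>UNIV. infsum (f i) UNIV)" .
  qed
qed (auto simp: prod_nonneg nonneg)

lemma poisson_prob_pos:
  assumes "\<And>i. c $ i > 0" "lam \<in> pos_orthant"
  shows "poisson_prob c x lam > 0"
  using assms unfolding poisson_prob_def pos_orthant_def
  by (intro prod_pos) (auto intro!: mult_pos_pos divide_pos_pos zero_less_power)

text \<open>In each coordinate the weight turns the exponential series at
  \<open>c $ i * lam $ i\<close> into the one at four times this value. The base 4 is chosen to
  dominate squares of the total count.\<close>

lemma summable_on_poisson_prob_exponential:
  fixes c lam :: "real ^ 'n"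
  assumes "\<And>i. c $ i > 0" "lam \<in> pos_orthant"
  shows "(\<lambda>x. poisson_prob c x lam * 4 ^ (\<Sum>i\<in>UNIV. x $ i)) summable_on UNIV"
proof -
  have lam: "c $ i * lam $ i > 0" for i
    using assms by (auto simp: pos_orthant_def)
  define f where "f = (\<lambda>i k. (c $ i * lam $ i) ^ k / fact k * exp (- (c $ i * lam $ i)) * 4 ^ k :: real)"
  have "f i summable_on UNIV" for i
  proof (rule summable_nonneg_imp_summable_on)
    have "summable (\<lambda>k. exp (- (c $ i * lam $ i)) * (inverse (fact k) * (4 * (c $ i * lam $ i)) ^ k))"
      by (intro summable_mult summable_exp)
    also have "(\<lambda>k. exp (- (c $ i * lam $ i)) * (inverse (fact k) * (4 * (c $ i * lam $ i)) ^ k)) = f i"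
      by (simp add: f_def fun_eq_iff power_mult_distrib field_simps)
    finally show "summable (f i)" .
  qed (use lam in \<open>auto simp: f_def less_imp_le\<close>)
  then have "(\<lambda>x :: nat ^ 'n. \<Prod>i\<in>UNIV. f i (x $ i)) summable_on UNIV"
    using lam by (intro summable_on_vec_prod) (auto simp: f_def less_imp_le)
  then show ?thesis
    by (simp only: f_def poisson_prob_def prod.distrib power_sum)
qed

section \<open>Functions whose logarithm grows at most quadratically\<close>

definition total :: "nat ^ 'n \<Rightarrow> nat ^ 'n \<Rightarrow> nat" where
  "total x y = (\<Sum>i\<in>UNIV. x $ i + y $ i)"

lemma nth_le_total: "x $ i + y $ i \<le> total x y"
  unfolding total_def by (rule member_le_sum) auto

text \<open>
  Closed under products and quotients, so that it passes to the likelihood ratios, while the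
  logarithm stays integrable against the Poisson distributions.
\<close>

definition log_growth :: "(nat ^ 'n \<Rightarrow> nat ^ 'n \<Rightarrow> real) \<Rightarrow> bool" where
  "log_growth f \<longleftrightarrow> (\<forall>x y. f x y > 0) \<and> (\<exists>C\<ge>0. \<forall>x y. \<bar>ln (f x y)\<bar> \<le> C * (1 + real (total x y))\<^sup>2)"

lemma log_growthI:
  assumes "\<And>x y. f x y > 0" "\<And>x y. \<bar>ln (f x y)\<bar> \<le> C * (1 + real (total x y))\<^sup>2"
  shows "log_growth f"
proof -
  have "\<bar>ln (f x y)\<bar> \<le> \<bar>C\<bar> * (1 + real (total x y))\<^sup>2" for x y
    by (rule order_trans [OF assms(2)]) (auto intro: mult_right_mono)
  then show ?thesis
    using assms(1) unfolding log_growth_def by (intro conjI exI [of _ "\<bar>C\<bar>"]) auto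
qed

lemma log_growth_pos: "log_growth f \<Longrightarrow> f x y > 0"
  by (auto simp: log_growth_def)

lemma log_growth_mult:
  assumes "log_growth f" "log_growth g"
  shows "log_growth (\<lambda>x y. f x y * g x y)"
proof -
  obtain C where C: "\<bar>ln (f x y)\<bar> \<le> C * (1 + real (total x y))\<^sup>2" for x y
    using assms(1) unfolding log_growth_def by blast
  obtain D where D: "\<bar>ln (g x y)\<bar> \<le> D * (1 + real (total x y))\<^sup>2" for x y
    using assms(2) unfolding log_growth_def by blast
  show ?thesis
  proof (rule log_growthI [where C = "C + D"])
    fix x y
    note pos = log_growth_pos [OF assms(1), of x y] log_growth_pos [OF assms(2), of x y]
    show "f x y * g x y > 0"
      using pos by simp
    show "\<bar>ln (f x y * g x y)\<bar> \<le> (C + D) * (1 + real (total x y))\<^sup>2"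
      using C [of x y] D [of x y] pos by (simp add: ln_mult ring_distribs)
  qed
qed

lemma log_growth_inverse:
  assumes "log_growth f"
  shows "log_growth (\<lambda>x y. inverse (f x y))"
  using assms by (auto simp: log_growth_def ln_inverse)

lemma log_growth_divide:
  assumes "log_growth f" "log_growth g"
  shows "log_growth (\<lambda>x y. f x y / g x y)"
  using log_growth_mult [OF assms(1) log_growth_inverse [OF assms(2)]] by (simp add: divide_inverse)

lemma log_growth_const: "c > 0 \<Longrightarrow> log_growth (\<lambda>x y. c)"
  by (rule log_growthI [where C = "\<bar>ln c\<bar>"]) (auto simp: mult_le_cancel_left1)

lemma log_growth_prod:
  fixes f :: "'i \<Rightarrow> nat ^ 'n \<Rightarrow> nat ^ 'n \<Rightarrow> real"
  assumes "\<And>i. log_growth (f i)"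
  shows "log_growth (\<lambda>x y. \<Prod>i\<in>A. f i x y)"
  by (induction A rule: infinite_finite_induct) (auto intro: log_growth_const log_growth_mult assms)

text \<open>The shift \<open>b\<close> makes room for the terms \<open>\<beta> $ i\<close> in the
  exponents of the predictive density.\<close>

lemma log_growth_powr:
  fixes g :: "nat ^ 'n \<Rightarrow> nat ^ 'n \<Rightarrow> real"
  assumes "c > 0" "\<And>x y. 0 \<le> g x y" "\<And>x y. g x y \<le> real (total x y) + b"
  shows "log_growth (\<lambda>x y. c powr g x y)"
proof (rule log_growthI [where C = "\<bar>ln c\<bar> * (1 + \<bar>b\<bar>)"])
  fix x y :: "nat ^ 'n"
  let ?N = "real (total x y)"
  have "\<bar>g x y\<bar> \<le> ?N + \<bar>b\<bar>"
    using assms(2) [of x y] assms(3) [of x y] by linarith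
  also have "\<dots> \<le> (1 + \<bar>b\<bar>) * (1 + ?N)"
    by (simp add: algebra_simps)
  also have "\<dots> \<le> (1 + \<bar>b\<bar>) * (1 + ?N)\<^sup>2"
    by (intro mult_left_mono) (auto simp: power2_eq_square)
  finally show "\<bar>ln (c powr g x y)\<bar> \<le> \<bar>ln c\<bar> * (1 + \<bar>b\<bar>) * (1 + ?N)\<^sup>2"
    using assms(1) by (simp add: ln_powr abs_mult mult.assoc mult.commute [of _ "\<bar>ln c\<bar>"] mult_left_mono)
qed (use assms in auto)

lemma log_growth_power:
  assumes "c > 0" "\<And>x y. n x y \<le> total x y"
  shows "log_growth (\<lambda>x y. c ^ n x y)"
  using log_growth_powr [of c "\<lambda>x y. real (n x y)" 0] assms by (simp add: powr_realpow)

text \<open>Induction by the functional equation: each step adds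
  \<open>\<bar>ln (real n + b)\<bar>\<close>, which is at most \<open>real n + b + 1 / b\<close>,
  and summing linear terms gives a quadratic bound. In the constant, the term in
  \<open>Gamma b\<close> serves \<open>n = 0\<close>, \<open>b + 1 / b\<close> the logarithm, and
  \<open>1\<close> the summand \<open>real n\<close>.\<close>

lemma abs_ln_Gamma_le:
  assumes "(b :: real) > 0"
  shows "\<bar>ln (Gamma (real n + b))\<bar> \<le> (\<bar>ln (Gamma b)\<bar> + b + 1 / b + 1) * (1 + real n)\<^sup>2"
proof (induction n)
  case (Suc n)
  let ?D = "\<bar>ln (Gamma b)\<bar> + b + 1 / b + 1"
  have D: "?D \<ge> b + 1 / b" "?D \<ge> 1"
    using assms by auto
  have "\<bar>ln t\<bar> \<le> t + 1 / b" if "t \<ge> b" for t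
  proof -
    have "t > 0"
      using that assms by simp
    have "ln t \<le> t - 1" "ln (1 / t) \<le> 1 / t - 1"
      using \<open>t > 0\<close> by (auto intro: ln_le_minus_one)
    moreover have "1 / t \<le> 1 / b"
      using that assms by (simp add: frac_le)
    moreover have "1 / b > 0" "1 / t > 0"
      using assms \<open>t > 0\<close> by simp_all
    moreover have "ln (1 / t) = - ln t"
      using \<open>t > 0\<close> by (simp add: ln_div)
    ultimately show ?thesis
      using \<open>t > 0\<close> by linarith
  qed
  then have "\<bar>ln (real n + b)\<bar> \<le> real n + b + 1 / b"
    by simp
  also have "\<dots> \<le> ?D * real n + ?D"
    using D mult_right_mono [OF D(2), of "real n"] by simp
  finally have 1: "\<bar>ln (real n + b)\<bar> \<le> ?D * real n + ?D" .
  have "Gamma (real (Suc n) + b) = (real n + b) * Gamma (real n + b)"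
    using assms Gamma_plus1 [of "real n + b"] nonpos_Ints_nonpos [of "real n + b"] by (auto simp: add_ac)
  then have "\<bar>ln (Gamma (real (Suc n) + b))\<bar> \<le> \<bar>ln (real n + b)\<bar> + \<bar>ln (Gamma (real n + b))\<bar>"
    using assms by (simp add: ln_mult Gamma_real_pos add_nonneg_pos abs_triangle_ineq)
  also have "\<dots> \<le> ?D * real n + ?D + ?D * (1 + real n)\<^sup>2"
    using 1 Suc by simp
  also have "\<dots> \<le> ?D * (1 + real (Suc n))\<^sup>2"
  proof -
    have "?D * (1 + real (Suc n))\<^sup>2 = ?D * real n + ?D + ?D * (1 + real n)\<^sup>2 + ?D * (real n + 2)"
      by (simp add: power2_eq_square algebra_simps)
    moreover have "?D * (real n + 2) \<ge> 0"
      using D by simp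
    ultimately show ?thesis
      by linarith
  qed
  finally show ?case .
qed (use assms in auto)

lemma log_growth_Gamma:
  assumes b: "b > 0" and n: "\<And>x y. n x y \<le> total x y"
  shows "log_growth (\<lambda>x y. Gamma (real (n x y) + b))"
proof (rule log_growthI)
  fix x y
  let ?D = "\<bar>ln (Gamma b)\<bar> + b + 1 / b + 1"
  show "Gamma (real (n x y) + b) > 0"
    using b by (simp add: Gamma_real_pos add_nonneg_pos)
  have "\<bar>ln (Gamma (real (n x y) + b))\<bar> \<le> ?D * (1 + real (n x y))\<^sup>2"
    by (rule abs_ln_Gamma_le) fact
  also have "\<dots> \<le> ?D * (1 + real (total x y))\<^sup>2"
    using b n [of x y] by (intro mult_left_mono power_mono) auto
  finally show "\<bar>ln (Gamma (real (n x y) + b))\<bar> \<le> ?D * (1 + real (total x y))\<^sup>2" .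
qed

lemma log_growth_fact:
  assumes "\<And>x y. n x y \<le> total x y"
  shows "log_growth (\<lambda>x y. fact (n x y))"
  using log_growth_Gamma [OF zero_less_one assms] by (simp add: Gamma_fact add.commute)

text \<open>The logarithm of \<open>g\<close> lies between two functions of quadratic growth. This
  serves \<open>K\<close>, which is estimated rather than evaluated.\<close>

lemma log_growth_sandwich:
  assumes "log_growth f" "log_growth h" "\<And>x y. f x y \<le> g x y" "\<And>x y. g x y \<le> h x y"
  shows "log_growth g"
proof -
  obtain C where C: "\<bar>ln (f x y)\<bar> \<le> C * (1 + real (total x y))\<^sup>2" for x y
    using assms(1) unfolding log_growth_def by blast
  obtain D where D: "\<bar>ln (h x y)\<bar> \<le> D * (1 + real (total x y))\<^sup>2" for x y
    using assms(2) unfolding log_growth_def by blast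
  show ?thesis
  proof (rule log_growthI [where C = "C + D"])
    fix x y
    note pos = log_growth_pos [OF assms(1), of x y]
    show *: "g x y > 0"
      using pos assms(3) [of x y] by simp
    have "ln (f x y) \<le> ln (g x y)" "ln (g x y) \<le> ln (h x y)"
      using pos * assms(3,4) [of x y] by (auto intro!: ln_mono)
    then show "\<bar>ln (g x y)\<bar> \<le> (C + D) * (1 + real (total x y))\<^sup>2"
      using C [of x y] D [of x y] by (simp add: ring_distribs)
  qed
qed

text \<open>Adding counts to the exponents multiplies the integrand by a factor of at most 1, which
  gives the upper bound. For the lower bound the integral is cut down to the unit interval, where
  this factor is at least \<open>?L x y\<close>.\<close>

lemma log_growth_K:
  fixes \<gamma> \<beta> :: "real ^ 'n" and n :: "'n \<Rightarrow> nat ^ 'n \<Rightarrow> nat ^ 'n \<Rightarrow> nat"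
  assumes \<gamma>: "\<And>i. \<gamma> $ i > 0" and \<beta>: "\<And>i. \<beta> $ i > 0" and \<alpha>: "0 < \<alpha>" "\<alpha> < (\<Sum>i\<in>UNIV. \<beta> $ i)"
    and n: "\<And>i x y. n i x y \<le> total x y"
  shows "log_growth (\<lambda>x y. K \<gamma> (\<chi> i. real (n i x y) + \<beta> $ i) \<alpha>)"
proof (rule log_growth_sandwich)
  let ?I = "LINT u:{0<..<1}|lborel. K_integrand \<gamma> \<beta> \<alpha> u"
  \<comment> \<open>The extra factor decreases in \<open>u\<close>, and this is its value at the
    right end \<open>u = 1\<close>.\<close>
  let ?L = "\<lambda>x y. \<Prod>i\<in>UNIV. inverse ((1 / \<gamma> $ i + 1) ^ n i x y)"
  note int = set_integrable_K_integrand [OF \<gamma> \<beta> \<alpha>]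
  have int01: "set_integrable lborel {0<..<1} (K_integrand \<gamma> \<beta> \<alpha>)"
    by (rule set_integrable_subset [OF int]) auto
  have base: "u / \<gamma> $ i + 1 \<ge> 1" if "u > 0" for u i
    using that \<gamma> [of i] by simp
  have eq: "K_integrand \<gamma> (\<chi> i. real (n i x y) + \<beta> $ i) \<alpha> u =
      (\<Prod>i\<in>UNIV. inverse ((u / \<gamma> $ i + 1) ^ n i x y)) * K_integrand \<gamma> \<beta> \<alpha> u" if "u > 0" for u x y
  proof -
    have "1 / (u / \<gamma> $ i + 1) powr (real (n i x y) + \<beta> $ i) =
        inverse ((u / \<gamma> $ i + 1) ^ n i x y) * (1 / (u / \<gamma> $ i + 1) powr (\<beta> $ i))" for i
      using base [OF that, of i] by (simp add: powr_add powr_realpow divide_inverse)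
    then show ?thesis
      by (simp only: K_integrand_def vec_lambda_beta prod.distrib mult_ac)
  qed
  have w: "\<alpha> < (\<Sum>i\<in>UNIV. (\<chi> i. real (n i x y) + \<beta> $ i) $ i)" for x y
    by (rule less_le_trans [OF \<alpha>(2)]) (auto intro: sum_mono)
  have int': "set_integrable lborel {0<..} (K_integrand \<gamma> (\<chi> i. real (n i x y) + \<beta> $ i) \<alpha>)" for x y
    using \<gamma> \<beta> \<alpha> w by (intro set_integrable_K_integrand) (auto simp: add_nonneg_pos)
  have "emeasure lborel {0<..<1::real} \<noteq> 0"
    by simp
  then have "?I > 0"
    using int01 \<gamma> by (intro set_lborel_integral_pos) (auto intro: K_integrand_pos)
  moreover have "1 / \<gamma> $ i + 1 > 0" for i
    using \<gamma> [of i] by (simp add: add_pos_pos)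
  ultimately show "log_growth (\<lambda>x y. ?L x y * ?I)"
    by (intro log_growth_mult log_growth_const log_growth_prod log_growth_inverse log_growth_power n)
  show "log_growth (\<lambda>x y. K \<gamma> \<beta> \<alpha>)"
    using assms by (intro log_growth_const K_pos)
  fix x y :: "nat ^ 'n"
  have "?L x y * ?I = (LINT u:{0<..<1}|lborel. ?L x y * K_integrand \<gamma> \<beta> \<alpha> u)"
    by simp
  also have "\<dots> \<le> (LINT u:{0<..<1}|lborel. K_integrand \<gamma> (\<chi> i. real (n i x y) + \<beta> $ i) \<alpha> u)"
  proof (rule set_integral_mono)
    show "set_integrable lborel {0<..<1} (K_integrand \<gamma> (\<chi> i. real (n i x y) + \<beta> $ i) \<alpha>)"
      by (rule set_integrable_subset [OF int']) auto
    fix u :: real assume "u \<in> {0<..<1}"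
    then show "?L x y * K_integrand \<gamma> \<beta> \<alpha> u \<le> K_integrand \<gamma> (\<chi> i. real (n i x y) + \<beta> $ i) \<alpha> u"
      by (subst eq) (auto intro!: mult_right_mono prod_mono le_imp_inverse_le power_mono K_integrand_nonneg
        zero_less_power add_nonneg_pos divide_right_mono simp: less_imp_le [OF \<gamma>] less_imp_le)
  qed (use int01 in simp)
  also have "\<dots> \<le> K \<gamma> (\<chi> i. real (n i x y) + \<beta> $ i) \<alpha>"
    using \<gamma> \<beta> \<alpha> w by (intro less_imp_le LINT_K_integrand_unit_less_K) (auto simp: add_nonneg_pos)
  finally show "?L x y * ?I \<le> K \<gamma> (\<chi> i. real (n i x y) + \<beta> $ i) \<alpha>" .
  show "K \<gamma> (\<chi> i. real (n i x y) + \<beta> $ i) \<alpha> \<le> K \<gamma> \<beta> \<alpha>"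
    unfolding K_eq
  proof (rule set_integral_mono [OF int' int])
    fix u :: real assume u: "u \<in> {0<..}"
    have "(\<Prod>i\<in>UNIV. inverse ((u / \<gamma> $ i + 1) ^ n i x y)) \<le> 1"
      using base [of u] u by (intro prod_le_1) (auto intro!: inverse_le_1_iff [THEN iffD2] one_le_power disjI2)
    then show "K_integrand \<gamma> (\<chi> i. real (n i x y) + \<beta> $ i) \<alpha> u \<le> K_integrand \<gamma> \<beta> \<alpha> u"
      using u by (subst eq) (auto intro!: mult_left_le_one_le K_integrand_nonneg prod_nonneg
        zero_le_power add_nonneg_nonneg simp: less_imp_le [OF \<gamma>])
  qed
qed

text \<open>The quadratic bound on the logarithm is dominated by an exponential in the total count,
  which splits into a function of \<open>x\<close> times a function of \<open>y\<close>.\<close>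

lemma summable_on_poisson_log_growth:
  fixes r s lam :: "real ^ 'n"
  assumes r: "\<And>i. r $ i > 0" and s: "\<And>i. s $ i > 0" and lam: "lam \<in> pos_orthant" and f: "log_growth f"
  shows "(\<lambda>(x, y). poisson_prob r x lam * poisson_prob s y lam * ln (f x y)) summable_on UNIV"
proof -
  obtain C where C: "C \<ge> 0" "\<bar>ln (f x y)\<bar> \<le> C * (1 + real (total x y))\<^sup>2" for x y
    using f unfolding log_growth_def by blast
  let ?p = "\<lambda>x. poisson_prob r x lam * 4 ^ (\<Sum>i\<in>UNIV. x $ i)"
  let ?q = "\<lambda>y. poisson_prob s y lam * 4 ^ (\<Sum>i\<in>UNIV. y $ i)"
  note pos = poisson_prob_pos [OF r lam] poisson_prob_pos [OF s lam]
  have "(\<lambda>(x, y). ?p x * ?q y) summable_on UNIV \<times> UNIV"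
  proof (rule summable_on_SigmaI)
    fix x
    show "((\<lambda>y. case (x, y) of (x, y) \<Rightarrow> ?p x * ?q y) has_sum ?p x * infsum ?q UNIV) UNIV"
      unfolding prod.case
      by (intro has_sum_cmult_right has_sum_infsum summable_on_poisson_prob_exponential s lam)
  qed (auto intro!: summable_on_cmult_left summable_on_poisson_prob_exponential r lam
      simp: pos [THEN less_imp_le])
  then have dom: "(\<lambda>xy. C * (case xy of (x, y) \<Rightarrow> ?p x * ?q y)) summable_on UNIV"
    by (intro summable_on_cmult_right) simp
  show ?thesis
  proof (rule Infinite_Sum.abs_summable_summable, rule Infinite_Sum.abs_summable_on_comparison_test' [OF dom])
    fix xy :: "(nat ^ 'n) \<times> (nat ^ 'n)"
    obtain x y where xy: "xy = (x, y)"
      by force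
    \<comment> \<open>Squaring this bound yields the weight \<open>4 ^ total x y\<close>.\<close>
    have "1 + real m \<le> 2 ^ m" for m
      by (induction m) auto
    then have "(1 + real (total x y))\<^sup>2 \<le> (2 ^ total x y)\<^sup>2"
      by (intro power_mono) auto
    also have "\<dots> = 4 ^ total x y"
      by (simp add: power2_eq_square flip: power_mult_distrib)
    also have "\<dots> = 4 ^ (\<Sum>i\<in>UNIV. x $ i) * 4 ^ (\<Sum>i\<in>UNIV. y $ i)"
      by (simp add: total_def sum.distrib power_add)
    finally have "C * (1 + real (total x y))\<^sup>2 \<le> C * (4 ^ (\<Sum>i\<in>UNIV. x $ i) * 4 ^ (\<Sum>i\<in>UNIV. y $ i))"
      using C(1) by (intro mult_left_mono)
    then have "\<bar>ln (f x y)\<bar> \<le> C * (4 ^ (\<Sum>i\<in>UNIV. x $ i) * 4 ^ (\<Sum>i\<in>UNIV. y $ i))"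
      using C(2) [of x y] by linarith
    then have "poisson_prob r x lam * poisson_prob s y lam * \<bar>ln (f x y)\<bar> \<le>
        poisson_prob r x lam * poisson_prob s y lam * (C * (4 ^ (\<Sum>i\<in>UNIV. x $ i) * 4 ^ (\<Sum>i\<in>UNIV. y $ i)))"
      using pos [of x] pos(2) [of y] by (intro mult_left_mono) auto
    then show "norm (case xy of (x, y) \<Rightarrow> poisson_prob r x lam * poisson_prob s y lam * ln (f x y)) \<le>
        C * (case xy of (x, y) \<Rightarrow> ?p x * ?q y)"
      using pos(1) [of x] pos(2) [of y] by (simp add: xy abs_mult mult_ac)
  qed
qed

lemma log_growth_poisson_prob:
  fixes s lam :: "real ^ 'n"
  assumes s: "\<And>i. s $ i > 0" and lam: "lam \<in> pos_orthant"
  shows "log_growth (\<lambda>x y. poisson_prob s y lam)"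
proof -
  have "s $ i * lam $ i > 0" for i
    using s lam by (auto simp: pos_orthant_def)
  moreover have "y $ i \<le> total x y" for x y :: "nat ^ 'n" and i
    using nth_le_total [of x i y] by simp
  ultimately show ?thesis
    unfolding poisson_prob_def
    by (intro log_growth_prod log_growth_mult log_growth_divide log_growth_power log_growth_fact
        log_growth_const) auto
qed

lemma log_growth_bayes_predictive_power_prior:
  fixes r s \<beta> :: "real ^ 'n"
  assumes r: "\<And>i. r $ i > 0" and s: "\<And>i. s $ i > 0" and \<beta>: "\<And>i. \<beta> $ i > 0"
  shows "log_growth (\<lambda>x y. bayes_predictive r s (power_prior \<beta>) y x)"
proof -
  have n: "x $ i \<le> total x y" "y $ i \<le> total x y" for x y :: "nat ^ 'n" and i
    using nth_le_total [of x i y] by simp_all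
  have rs: "r $ i + s $ i > 0" for i
    using r s by (simp add: add_pos_pos)
  have "real (x $ i) + real (y $ i) \<le> real (total x y)" for x y :: "nat ^ 'n" and i
    using nth_le_total [of x i y] by linarith
  then have "log_growth (\<lambda>x y. (r $ i + s $ i) powr (real (x $ i) + real (y $ i) + \<beta> $ i))" for i
    using \<beta> by (intro log_growth_powr [where b = "\<beta> $ i"] rs [of i]) (auto simp: less_imp_le)
  moreover have "log_growth (\<lambda>x y. r $ i powr (real (x $ i) + \<beta> $ i))" for i
    using \<beta> n by (intro log_growth_powr [where b = "\<beta> $ i"] r) (auto simp: less_imp_le)
  moreover have "log_growth (\<lambda>x y. Gamma (real (x $ i) + real (y $ i) + \<beta> $ i))" for i
    using log_growth_Gamma [OF \<beta> nth_le_total [of _ i]] by simp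
  ultimately show ?thesis
    unfolding bayes_predictive_power_prior [OF assms]
    using n by (intro log_growth_prod log_growth_mult log_growth_divide log_growth_power log_growth_fact
        log_growth_Gamma \<beta> s) auto
qed

section \<open>Comparison of the risks\<close>

text \<open>The pairs \<open>(x, y)\<close> are regrouped by their sum \<open>z = x + y\<close>.
  Subtraction of naturals is exact here since \<open>x \<le> z\<close>, so \<open>(z, x)\<close>
  determines the pair and each group is finite.\<close>

lemma infsum_group_sum_pos:
  fixes f :: "nat ^ 'n \<Rightarrow> nat ^ 'n \<Rightarrow> real"
  assumes f: "(\<lambda>(x, y). f x y) summable_on UNIV" and pos: "\<And>z. (\<Sum>x\<in>{..z}. f x (z - x)) > 0"
  shows "(\<Sum>\<^sub>\<infinity>(x, y). f x y) > 0"
proof -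
  have bij: "bij_betw (\<lambda>(z, x). (x, z - x)) (Sigma UNIV (\<lambda>z :: nat ^ 'n. {..z})) UNIV"
    by (rule bij_betw_byWitness [where f' = "\<lambda>(x, y). (x + y, x)"])
      (auto simp: less_eq_vec_def vec_eq_iff)
  have sum: "(\<lambda>(z, x). f x (z - x)) summable_on Sigma UNIV (\<lambda>z. {..z})"
    using summable_on_reindex_bij_betw [OF bij, of "\<lambda>(x, y). f x y"] f by (simp add: case_prod_unfold)
  have "(\<lambda>z. \<Sum>\<^sub>\<infinity>x\<in>{..z}. f x (z - x)) summable_on UNIV"
    by (rule summable_on_Sigma_banach [OF sum])
  then have "(\<lambda>z. \<Sum>x\<in>{..z}. f x (z - x)) summable_on UNIV"
    by (simp add: finite_atMost_vec)
  \<comment> \<open>The single group \<open>z = 0\<close> already bounds the whole sum from below by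
    a positive number, as the other groups are nonnegative.\<close>
  then have "(\<Sum>z\<in>{0}. \<Sum>x\<in>{..z}. f x (z - x)) \<le> (\<Sum>\<^sub>\<infinity>z. \<Sum>x\<in>{..z}. f x (z - x))"
    by (rule finite_sum_le_infsum) (auto simp: less_imp_le [OF pos])
  then have "0 < (\<Sum>\<^sub>\<infinity>z. \<Sum>x\<in>{..z}. f x (z - x))"
    using pos [of 0] by simp
  also have "\<dots> = (\<Sum>\<^sub>\<infinity>z. \<Sum>\<^sub>\<infinity>x\<in>{..z}. f x (z - x))"
    by (simp add: finite_atMost_vec)
  also have "\<dots> = (\<Sum>\<^sub>\<infinity>(z, x)\<in>Sigma UNIV (\<lambda>z. {..z}). f x (z - x))"
    by (rule infsum_Sigma'_banach [OF sum])
  also have "\<dots> = (\<Sum>\<^sub>\<infinity>(x, y). f x y)"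
    using infsum_reindex_bij_betw [OF bij, of "\<lambda>(x, y). f x y"] by (simp add: case_prod_unfold)
  finally show ?thesis .
qed

text \<open>Up to the factor \<open>poisson_prob (r + s) z lam\<close>, this is the conditional
  expectation of the logarithm of the correction factor given the total \<open>z\<close>.\<close>

lemma sum_poisson_ln_K_ratio_pos:
  fixes r s \<beta> lam :: "real ^ 'n"
  assumes r: "\<And>i. r $ i > 0" and s: "\<And>i. s $ i > 0" and \<beta>: "\<And>i. \<beta> $ i > 0"
    and \<alpha>: "\<alpha> = (\<Sum>i\<in>UNIV. \<beta> $ i) - 1" "\<alpha> > 0" and lam: "lam \<in> pos_orthant"
  shows "(\<Sum>x\<in>{..z}. poisson_prob r x lam * poisson_prob s (z - x) lam *
      ln (K (\<chi> i. s $ i / r $ i) (\<chi> i. real (z $ i) + \<beta> $ i) \<alpha> /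
          K (\<chi> i. s $ i / (r $ i + s $ i)) (\<chi> i. real (x $ i) + \<beta> $ i) \<alpha>)) > 0"
proof -
  let ?k = "\<lambda>x. K (\<chi> i. s $ i / (r $ i + s $ i)) (\<chi> i. real (x $ i) + \<beta> $ i) \<alpha>"
  let ?k' = "K (\<chi> i. s $ i / r $ i) (\<chi> i. real (z $ i) + \<beta> $ i) \<alpha>"
  let ?p = "\<lambda>x. poisson_prob r x lam * poisson_prob s (z - x) lam"
  have w: "\<alpha> < (\<Sum>i\<in>UNIV. (\<chi> i. real (x $ i) + \<beta> $ i) $ i)" for x :: "nat ^ 'n"
    by (rule less_le_trans [of _ "\<Sum>i\<in>UNIV. \<beta> $ i"]) (auto intro: sum_mono simp: \<alpha>)
  have rs: "s $ i / (r $ i + s $ i) > 0" "s $ i / r $ i > 0" for i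
    using r [of i] s [of i] by auto
  have k: "?k x > 0" for x
    using rs \<beta> \<alpha>(2) w by (intro K_pos) (auto simp: add_nonneg_pos)
  have k': "?k' > 0"
    using rs \<beta> \<alpha>(2) w by (intro K_pos) (auto simp: add_nonneg_pos)
  have "(\<Sum>x\<in>{..z}. ?p x * ?k x) < poisson_prob (r + s) z lam * ?k'"
    by (rule sum_poisson_K_less) fact+
  then have "0 < (poisson_prob (r + s) z lam * ?k' - (\<Sum>x\<in>{..z}. ?p x * ?k x)) / ?k'"
    using k' by simp
  \<comment> \<open>The weights \<open>?p x\<close> add up to
    \<open>poisson_prob (r + s) z lam\<close>, so the constant term can be moved under the
    sum.\<close>
  also have "\<dots> = (\<Sum>x\<in>{..z}. ?p x * (1 - ?k x / ?k'))"
    using k' by (simp add: sum_poisson_convolution [symmetric] right_diff_distrib sum_subtractf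
        sum_divide_distrib sum_distrib_right diff_divide_distrib)
  also have "\<dots> \<le> (\<Sum>x\<in>{..z}. ?p x * ln (?k' / ?k x))"
  proof (intro sum_mono mult_left_mono)
    fix x
    have "ln (?k x / ?k') \<le> ?k x / ?k' - 1"
      using k [of x] k' by (intro ln_le_minus_one) simp
    then show "1 - ?k x / ?k' \<le> ln (?k' / ?k x)"
      using k [of x] k' by (simp add: ln_div)
    show "0 \<le> ?p x"
      using poisson_prob_pos [OF r lam] poisson_prob_pos [OF s lam] by (simp add: less_imp_le)
  qed
  finally show ?thesis .
qed

text \<open>An \<open>infsum\<close> of a family that is not summable is 0 by convention. The two
  summability claims exclude this, so that the risks compared are genuine values of the double
  series.\<close>

theorem theorem1:
  fixes r s \<beta> \<gamma> :: "real ^ 'n" and \<alpha> :: real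
  assumes "\<And>i. 0 < r $ i" and "\<And>i. 0 < s $ i" and "\<And>i. 0 < \<beta> $ i"
    and "(\<Sum>i\<in>UNIV. \<beta> $ i) > 1"
    and "\<alpha> = (\<Sum>i\<in>UNIV. \<beta> $ i) - 1"
    and "\<gamma> = (\<chi> i. 1 / r $ i - 1 / (r $ i + s $ i))"
  shows "(\<forall>x y :: nat ^ 'n.
            bayes_predictive r s (shrinkage_prior \<beta> \<gamma> \<alpha>) y x =
              bayes_predictive r s (power_prior \<beta>) y x *
              (K (\<chi> i. s $ i / r $ i) (\<chi> i. real (x $ i) + real (y $ i) + \<beta> $ i) \<alpha> /
               K (\<chi> i. s $ i / (r $ i + s $ i)) (\<chi> i. real (x $ i) + \<beta> $ i) \<alpha>)) \<and>
         (\<forall>lam\<in>pos_orthant.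
            (\<lambda>(x, y). kl_term r s (bayes_predictive r s (shrinkage_prior \<beta> \<gamma> \<alpha>)) lam x y)
              summable_on UNIV \<and>
            (\<lambda>(x, y). kl_term r s (bayes_predictive r s (power_prior \<beta>)) lam x y)
              summable_on UNIV \<and>
            risk r s (bayes_predictive r s (shrinkage_prior \<beta> \<gamma> \<alpha>)) lam <
            risk r s (bayes_predictive r s (power_prior \<beta>)) lam)"
proof -
  note r = assms(1) and s = assms(2) and \<beta> = assms(3)
  have \<alpha>: "\<alpha> > 0" "\<alpha> < (\<Sum>i\<in>UNIV. \<beta> $ i)"
    using assms(4,5) by auto
  have rs: "s $ i / (r $ i + s $ i) > 0" "s $ i / r $ i > 0" for i
    using r [of i] s [of i] by auto
  define q where "q = (\<lambda>x y. bayes_predictive r s (power_prior \<beta>) y x)"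
  define \<rho> where "\<rho> = (\<lambda>x y. K (\<chi> i. s $ i / r $ i) (\<chi> i. real (x $ i) + real (y $ i) + \<beta> $ i) \<alpha> /
    K (\<chi> i. s $ i / (r $ i + s $ i)) (\<chi> i. real (x $ i) + \<beta> $ i) \<alpha>)"
  have eq: "bayes_predictive r s (shrinkage_prior \<beta> \<gamma> \<alpha>) y x = q x y * \<rho> x y" for x y
    unfolding q_def \<rho>_def by (rule bayes_predictive_shrinkage_prior) fact+
  have q: "log_growth q"
    unfolding q_def using r s \<beta> by (rule log_growth_bayes_predictive_power_prior)
  have \<rho>: "log_growth \<rho>"
    unfolding \<rho>_def
  proof (rule log_growth_divide)
    show "log_growth (\<lambda>x y :: nat ^ 'n. K (\<chi> i. s $ i / r $ i) (\<chi> i. real (x $ i) + real (y $ i) + \<beta> $ i) \<alpha>)"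
      using log_growth_K [where \<gamma> = "\<chi> i. s $ i / r $ i" and n = "\<lambda>i x y. x $ i + y $ i", OF _ \<beta> \<alpha> nth_le_total] rs by simp
    show "log_growth (\<lambda>x y :: nat ^ 'n. K (\<chi> i. s $ i / (r $ i + s $ i)) (\<chi> i. real (x $ i) + \<beta> $ i) \<alpha>)"
      using log_growth_K [where \<gamma> = "\<chi> i. s $ i / (r $ i + s $ i)" and n = "\<lambda>i x y. x $ i",
          OF _ \<beta> \<alpha> add_leD1 [OF nth_le_total]] rs by simp
  qed
  have risk: "(\<lambda>(x, y). kl_term r s (bayes_predictive r s (shrinkage_prior \<beta> \<gamma> \<alpha>)) lam x y) summable_on UNIV \<and>
      (\<lambda>(x, y). kl_term r s (bayes_predictive r s (power_prior \<beta>)) lam x y) summable_on UNIV \<and>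
      risk r s (bayes_predictive r s (shrinkage_prior \<beta> \<gamma> \<alpha>)) lam <
      risk r s (bayes_predictive r s (power_prior \<beta>)) lam" if lam: "lam \<in> pos_orthant" for lam
  proof -
    let ?q = "\<lambda>y x. q x y" and ?q' = "\<lambda>y x. q x y * \<rho> x y"
    \<comment> \<open>The termwise difference of the two divergences: the quotient of the predictive
      densities is \<open>\<rho>\<close>, so the sum of \<open>D\<close> is the difference of the
      risks.\<close>
    define D where "D = (\<lambda>x y. poisson_prob r x lam * poisson_prob s y lam * ln (\<rho> x y))"
    note p = log_growth_poisson_prob [OF s lam]
    note summable = summable_on_poisson_log_growth [OF r s lam]
    have kl: "(\<lambda>(x, y). kl_term r s ?q lam x y) summable_on UNIV"
      unfolding kl_term_def by (intro summable log_growth_divide p q)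
    have kl': "(\<lambda>(x, y). kl_term r s ?q' lam x y) summable_on UNIV"
      unfolding kl_term_def by (intro summable log_growth_divide log_growth_mult p q \<rho>)
    have D: "(\<lambda>(x, y). D x y) summable_on UNIV"
      unfolding D_def by (intro summable \<rho>)
    have "kl_term r s ?q lam x y = kl_term r s ?q' lam x y + D x y" for x y
      using log_growth_pos [OF q, of x y] log_growth_pos [OF \<rho>, of x y] poisson_prob_pos [OF s lam, of y]
      by (simp add: kl_term_def D_def ln_div ln_mult ring_distribs)
    then have "(\<Sum>\<^sub>\<infinity>(x, y). kl_term r s ?q lam x y) = (\<Sum>\<^sub>\<infinity>(x, y). kl_term r s ?q' lam x y) + (\<Sum>\<^sub>\<infinity>(x, y). D x y)"
      using infsum_add [OF kl' D] by (simp add: case_prod_unfold)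
    moreover have "(\<Sum>\<^sub>\<infinity>(x, y). D x y) > 0"
    proof (rule infsum_group_sum_pos [OF D])
      fix z :: "nat ^ 'n"
      \<comment> \<open>Within a group \<open>x + (z - x) = z\<close>, so the numerator of
        \<open>\<rho>\<close> depends on \<open>z\<close> alone.\<close>
      have "(\<Sum>x\<in>{..z}. D x (z - x)) = (\<Sum>x\<in>{..z}. poisson_prob r x lam * poisson_prob s (z - x) lam *
        ln (K (\<chi> i. s $ i / r $ i) (\<chi> i. real (z $ i) + \<beta> $ i) \<alpha> /
          K (\<chi> i. s $ i / (r $ i + s $ i)) (\<chi> i. real (x $ i) + \<beta> $ i) \<alpha>))"
        by (intro sum.cong refl) (auto simp: D_def \<rho>_def less_eq_vec_def of_nat_diff)
      also have "\<dots> > 0"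
        by (rule sum_poisson_ln_K_ratio_pos) fact+
      finally show "(\<Sum>x\<in>{..z}. D x (z - x)) > 0" .
    qed
    \<comment> \<open>Joint summability identifies the iterated sums in \<open>risk\<close> with
      sums over pairs.\<close>
    moreover have "risk r s ?q lam = (\<Sum>\<^sub>\<infinity>(x, y). kl_term r s ?q lam x y)"
      "risk r s ?q' lam = (\<Sum>\<^sub>\<infinity>(x, y). kl_term r s ?q' lam x y)"
      unfolding risk_def using infsum_Sigma'_banach [of "kl_term r s ?q lam" UNIV "\<lambda>_. UNIV"]
        infsum_Sigma'_banach [of "kl_term r s ?q' lam" UNIV "\<lambda>_. UNIV"] kl kl' by simp_all
    moreover have "bayes_predictive r s (shrinkage_prior \<beta> \<gamma> \<alpha>) = ?q'"
      "bayes_predictive r s (power_prior \<beta>) = ?q"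
      by (auto simp: fun_eq_iff eq q_def)
    ultimately show ?thesis
      using kl kl' by simp
  qed
  show ?thesis
    using risk eq unfolding q_def \<rho>_def by blast
qed

end
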